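(* Consider the exponential model. Let $\lambda,l,m>0$ and suppose that $\alpha$ and $\beta$ are the uniform distributions on $[\lambda/2,\lambda/2+l]$ and $[\lambda/2,\lambda/2+m]$, respectively. Then, for all $s,t>0$, the shape function $g$ satisfies $$\begin{aligned}g(s,t)&=\frac{s}{l}\log\left(1+\frac{l}{\lambda}+\frac{l}{\lambda}\cdot\frac{lt-ms+\sqrt{(lt-ms)^2+4st(\lambda+l)(\lambda+m)}}{2s(\lambda+m)}\right)\\&\quad+\frac{t}{m}\log\left(1+\frac{m}{\lambda}+\frac{m}{\lambda}\cdot\frac{ms-lt+\sqrt{(lt-ms)^2+4st(\lambda+l)(\lambda+m)}}{2t(\lambda+l)}\right).\end{aligned}$$
   Context: $\mathbb{N}=\{1,2,\dots\}$, $\mathbb{Z}_+=\{0,1,2,\dots\}$, $\mathbb{R}_+=[0,\infty)$; $\lfloor x\rfloor$ is the integer part; $x\vee y=\max\{x,y\}$. Environment. Let $\mathbf{a}=(a_n)_{n\in\mathbb{N}}$ and $\mathbf{b}=(b_n)_{n\in\mathbb{N}}$ be stationary random sequences in $(0,\infty)$, and let $\mu$ be the distribution of $(\mathbf{a},\mathbf{b})$. For $k\in\mathbb{Z}_+$ let $\tau_k$ be the shift $(c_n)_{n\in\mathbb{N}}\mapsto(c_{n+k})_{n\in\mathbb{N}}$. It is assumed that $\mu$ is (stationary and) ergodic under the map $\tau_k\times\tau_l:(\mathbf{a},\mathbf{b})\mapsto(\tau_k\mathbf{a},\tau_l\mathbf{b})$ for each $k,l\in\mathbb{N}$. Let $\alpha,\beta$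 be the distributions of $a_1,b_1$ under $\mu$. Exponential model. Given $(\mathbf{a},\mathbf{b})$, the weights $W(i,j)$, $i,j\in\mathbb{N}$, are (conditionally) independent and $W(i,j)$ is exponentially distributed with rate $a_i+b_j$. Their conditional joint law (a product measure on $\mathbb{R}_+^{\mathbb{N}^2}$) is $\mathbf{P}_{\mathbf{a},\mathbf{b}}$, and $\mathbb{P}(\cdot)=\int\mathbf{P}_{\mathbf{a},\mathbf{b}}(\cdot)\,\mu(d\mathbf{a},d\mathbf{b})$ is the joint law of the weights. Last-passage times. $G(i,j)=G(i-1,j)\vee G(i,j-1)+W(i,j)$ for $i,j\in\mathbb{N}$, with $G(i,0)=G(0,j)=0$. Equivalently, $G(m,n)$ is the maximum over all directed paths $\pi$ from $(1,1)$ to $(m,n)$ with steps $(1,0)$ or $(0,1)$ of $\sum_{(i,j)\in\pi}W(i,j)$. Shape function. There is a deterministic function $g:(0,\infty)^2\to[0,\infty]$, called the shape function, such that $\mathbb{P}$-a.s. $\lim_{n\to\infty}G(\lfloor ns\rfloor,\lfloor nt\rfloor)/n=g(s,t)$ for all $s,t>0$. *)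

theory Defs
  imports "HOL-Probability.Probability"
begin

text \<open>
  Sequences and arrays are indexed by positive integers, hence the index sets
  \<open>{1..}\<close> and the extensional function spaces of \<^const>\<open>PiM\<close>.
  The sequences in the environment take values in \<open>(0, \<infinity>)\<close> everywhere rather than
  almost everywhere, so every rate \<open>a i + b j\<close> is positive and \<open>cond_weight_law\<close> below
  is a probability kernel on the whole environment space (which \<^const>\<open>Giry_Monad.bind\<close> needs).
\<close>

definition pos_seq_space :: "(nat \<Rightarrow> real) measure" where
  "pos_seq_space = (\<Pi>\<^sub>M n\<in>{1..}. restrict_space borel {0<..})"

definition env_space :: "((nat \<Rightarrow> real) \<times> (nat \<Rightarrow> real)) measure" where
  "env_space = pos_seq_space \<Otimes>\<^sub>M pos_seq_space"

definition shift_seq :: "nat \<Rightarrow> (nat \<Rightarrow> real) \<Rightarrow> nat \<Rightarrow> real" where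
  "shift_seq k c = (\<lambda>n\<in>{1..}. c (n + k))"

definition shift2 ::
  "nat \<Rightarrow> nat \<Rightarrow> (nat \<Rightarrow> real) \<times> (nat \<Rightarrow> real) \<Rightarrow> (nat \<Rightarrow> real) \<times> (nat \<Rightarrow> real)" where
  "shift2 k l = (\<lambda>(a, b). (shift_seq k a, shift_seq l b))"

definition measure_preserving_map :: "'a measure \<Rightarrow> ('a \<Rightarrow> 'a) \<Rightarrow> bool" where
  "measure_preserving_map M T \<longleftrightarrow> T \<in> measurable M M \<and> distr M M T = M"

definition ergodic_map :: "'a measure \<Rightarrow> ('a \<Rightarrow> 'a) \<Rightarrow> bool" where
  "ergodic_map M T \<longleftrightarrow> measure_preserving_map M T \<and>
     (\<forall>A\<in>sets M. T -` A \<inter> space M = A \<longrightarrow> measure M A = 0 \<or> measure M A = 1)"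

text \<open>Stationarity of the two marginal sequences is implied by the case \<open>k = l = 1\<close>.\<close>

definition ergodic_environment :: "((nat \<Rightarrow> real) \<times> (nat \<Rightarrow> real)) measure \<Rightarrow> bool" where
  "ergodic_environment \<mu> \<longleftrightarrow> prob_space \<mu> \<and> sets \<mu> = sets env_space \<and>
     (\<forall>k\<ge>1. \<forall>l\<ge>1. ergodic_map \<mu> (shift2 k l))"

definition a1_law :: "((nat \<Rightarrow> real) \<times> (nat \<Rightarrow> real)) measure \<Rightarrow> real measure" where
  "a1_law \<mu> = distr \<mu> borel (\<lambda>(a, b). a 1)"

definition b1_law :: "((nat \<Rightarrow> real) \<times> (nat \<Rightarrow> real)) measure \<Rightarrow> real measure" where
  "b1_law \<mu> = distr \<mu> borel (\<lambda>(a, b). b 1)"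

definition cond_weight_law ::
  "(nat \<Rightarrow> real) \<times> (nat \<Rightarrow> real) \<Rightarrow> (nat \<times> nat \<Rightarrow> real) measure" where
  "cond_weight_law = (\<lambda>(a, b). \<Pi>\<^sub>M (i, j)\<in>{1..} \<times> {1..}.
     density lborel (exponential_density (a i + b j)))"

definition weight_law ::
  "((nat \<Rightarrow> real) \<times> (nat \<Rightarrow> real)) measure \<Rightarrow> (nat \<times> nat \<Rightarrow> real) measure" where
  "weight_law \<mu> = \<mu> \<bind> cond_weight_law"

fun last_passage :: "(nat \<times> nat \<Rightarrow> real) \<Rightarrow> nat \<Rightarrow> nat \<Rightarrow> real" where
  "last_passage W 0 j = 0"
| "last_passage W (Suc i) 0 = 0"
| "last_passage W (Suc i) (Suc j) =
     max (last_passage W i (Suc j)) (last_passage W (Suc i) j) + W (Suc i, Suc j)"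

text \<open>
  Only the values of \<open>g\<close> on \<open>(0, \<infinity>)\<^sup>2\<close> matter; there \<open>g\<close> is determined uniquely and may be \<open>\<infinity>\<close>.
  The exceptional null set does not depend on \<open>s\<close> and \<open>t\<close>.
\<close>

definition is_shape_function ::
  "((nat \<Rightarrow> real) \<times> (nat \<Rightarrow> real)) measure \<Rightarrow> (real \<Rightarrow> real \<Rightarrow> ereal) \<Rightarrow> bool" where
  "is_shape_function \<mu> g \<longleftrightarrow> (\<forall>s>0. \<forall>t>0. 0 \<le> g s t) \<and>
     (AE W in weight_law \<mu>. \<forall>s>0. \<forall>t>0.
        (\<lambda>n. ereal (last_passage W (nat \<lfloor>real n * s\<rfloor>) (nat \<lfloor>real n * t\<rfloor>) / real n))
          \<longlonglongrightarrow> g s t)"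

end

theory Submission imports Defs begin

text \<open>
  The shape function is the critical value of an explicit function. For a tilt \<open>z\<close> with
  \<open>\<bar>z\<bar> < lam / 2\<close> let \<open>A z\<close> and \<open>B z\<close> be the expectations of \<open>1 / (a 1 + z)\<close> and \<open>1 / (b 1 - z)\<close>, and
  let \<open>L z = s * A z + t * B z\<close>. The claim is that \<open>g s t = L z\<close> at the point \<open>z\<close> where \<open>L\<close> is
  stationary; for uniform marginals \<open>A\<close> and \<open>B\<close> are differences of logarithms, the critical
  equation is quadratic, and its solution gives the formula.

  Fix the environment. Add independent exponential weights with rate \<open>a i + z\<close> at the boundary
  sites \<open>(i, 0)\<close> and with rate \<open>b j - z\<close> at \<open>(0, j)\<close>. Reading the tilt as \<open>a 0 = - z\<close> and
  \<open>b 0 = z\<close>, every rate has the form \<open>a i + b j\<close>, and the model has the Burke property: passing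
  through one cell of the grid keeps a pair of increments of the passage time independent and
  exponential with their old rates (\<open>exponential_family_flip\<close>). Hence the horizontal increments along
  every row are independent with rates \<open>a i + z\<close> (\<open>passage_increments_exponential\<close>). The passage
  time to \<open>(i, j)\<close> is therefore the sum of two sums of independent exponential variables,
  with mean \<open>(\<Sum>k=1..i. 1 / (a k + z)) + (\<Sum>k=1..j. 1 / (b k - z))\<close> and with a variance at most
  linear in \<open>i + j\<close>. By the ergodic theorem for the environment (\<open>ergodic_averages_converge\<close>),
  the passage times with boundary therefore grow at speed \<open>L z\<close> in the direction \<open>(s, t)\<close>
  (\<open>stationary_passage_limit\<close>).

  Since the boundary weights are nonnegative, removing them gives \<open>g s t \<le> L z\<close> for every \<open>z\<close>.
  For the converse, the boundaries of all tilts are coupled by scaling the same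
  exponential variables, so that for \<open>w < z < w'\<close> the horizontal boundary weights of \<open>z\<close> are smaller
  than those of \<open>w\<close>, and the vertical ones are smaller than those of \<open>w'\<close>. An optimal path for \<open>z\<close> leaves
  the boundary within \<open>\<epsilon> * n\<close> steps, or uses more than \<open>\<epsilon> * n\<close> horizontal boundary steps, or uses more
  than \<open>\<epsilon> * n\<close> vertical ones. Up to
  the factor \<open>n\<close>, the three cases contribute at most \<open>\<epsilon> * A z + \<epsilon> * B z + g s t\<close>,
  \<open>\<epsilon> * (A z - A w) + L w\<close> and \<open>\<epsilon> * (B z - B w') + L w'\<close> (\<open>stationary_constant_le_max\<close>). Because
  \<open>L\<close> is stationary at \<open>z\<close> while \<open>A\<close> has a negative and \<open>B\<close> a positive derivative there,
  the last two numbers are smaller than \<open>L z\<close> for \<open>w\<close> and \<open>w'\<close> close to \<open>z\<close>. The first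
  case must prevail, and \<open>\<epsilon> \<rightarrow> 0\<close> gives \<open>L z \<le> g s t\<close>
  (\<open>passage_constant_at_critical_tilt\<close>).

  Almost sure limits are taken along the squares \<open>n\<^sup>2\<close>: there the variances of the normalised sums are
  summable, so that second moments suffice, and the limit of \<open>G / n\<close> is determined by any subsequence.
\<close>

section \<open>Passage times with boundary weights\<close>

text \<open>
  Passage times from the origin in the quadrant that includes the axes: paths collect boundary weights
  as long as they stay on an axis. The origin itself carries no weight.
\<close>
fun boundary_passage :: "(nat \<times> nat \<Rightarrow> real) \<Rightarrow> nat \<Rightarrow> nat \<Rightarrow> real" where
  "boundary_passage X 0 0 = 0"
| "boundary_passage X (Suc i) 0 = boundary_passage X i 0 + X (Suc i, 0)"
| "boundary_passage X 0 (Suc j) = boundary_passage X 0 j + X (0, Suc j)"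
| "boundary_passage X (Suc i) (Suc j) =
     max (boundary_passage X i (Suc j)) (boundary_passage X (Suc i) j) + X (Suc i, Suc j)"

lemma boundary_passage_bottom: "boundary_passage X i 0 = (\<Sum>k\<in>{1..i}. X (k, 0))"
  by (induction i) (auto simp: sum.nat_ivl_Suc')

lemma boundary_passage_left: "boundary_passage X 0 j = (\<Sum>k\<in>{1..j}. X (0, k))"
  by (induction j) (auto simp: sum.nat_ivl_Suc')

lemma last_passage_zero [simp]: "last_passage W i 0 = 0"
  by (cases i) auto

lemma last_passage_le_boundary_passage:
  assumes h: "\<And>i. i \<ge> 1 \<Longrightarrow> 0 \<le> X (i, 0)" and v: "\<And>j. j \<ge> 1 \<Longrightarrow> 0 \<le> X (0, j)"
    and int: "\<And>i j. i \<ge> 1 \<Longrightarrow> j \<ge> 1 \<Longrightarrow> X (i, j) = W (i, j)"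
  shows "last_passage W i j \<le> boundary_passage X i j"
proof (induction "i + j" arbitrary: i j rule: less_induct)
  case less
  consider "i = 0" "j = 0" | i' where "i = Suc i'" "j = 0" | j' where "i = 0" "j = Suc j'"
    | i' j' where "i = Suc i'" "j = Suc j'"
    by (cases i; cases j) auto
  then show ?case
  proof cases
    case 2
    then show ?thesis using less[of i' 0] h[of i] by simp
  next
    case 3
    then show ?thesis using less[of 0 j'] v[of j] by simp
  next
    case 4
    then show ?thesis using less[of i' j] less[of i j'] int[of i j] by auto
  qed simp
qed

text \<open>
  Passage times obey a recursion that is linear over the \<open>(max, +)\<close> semiring and monotone in
  the boundary values. All three passage times on the right satisfy the same recursion in the interior, even after
  adding a constant, so it suffices to compare boundary values. Up to index \<open>K\<close> the
  boundary values of \<open>X\<close> are at most the constant in the first term; beyond \<open>K\<close> the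
  increments of \<open>X\<close> are dominated by those of \<open>Y\<close> (bottom) or \<open>Z\<close> (left).
\<close>
lemma boundary_passage_le_max:
  assumes int: "\<And>i j. i \<ge> 1 \<Longrightarrow> j \<ge> 1 \<Longrightarrow> X (i, j) = W (i, j) \<and> Y (i, j) = W (i, j) \<and> Z (i, j) = W (i, j)"
    and h: "\<And>i. i \<ge> 1 \<Longrightarrow> 0 \<le> X (i, 0) \<and> X (i, 0) \<le> Y (i, 0)"
    and v: "\<And>j. j \<ge> 1 \<Longrightarrow> 0 \<le> X (0, j) \<and> X (0, j) \<le> Z (0, j)"
  shows "boundary_passage X i j \<le> max (boundary_passage X K 0 + boundary_passage X 0 K + last_passage W i j)
     (max (boundary_passage X K 0 - boundary_passage Y K 0 + boundary_passage Y i j)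
          (boundary_passage X 0 K - boundary_passage Z 0 K + boundary_passage Z i j))"
    (is "_ \<le> max (?C i j) (max (?H i j) (?V i j))")
proof -
  have pos: "0 \<le> boundary_passage X i 0" "0 \<le> boundary_passage X 0 i" for i
    using h v by (auto simp: boundary_passage_bottom boundary_passage_left intro!: sum_nonneg)
  have bottom: "boundary_passage X i 0 \<le> max (?C i 0) (?H i 0)" for i
  proof (cases "i \<le> K")
    case True
    then have "boundary_passage X i 0 \<le> boundary_passage X K 0"
      using h by (auto simp: boundary_passage_bottom intro!: sum_mono2)
    then show ?thesis using pos(2)[of K] by simp
  next
    case False
    then have *: "{1..i} = {1..K} \<union> {K<..i}" by auto
    have "boundary_passage U i 0 = boundary_passage U K 0 + (\<Sum>k\<in>{K<..i}. U (k, 0))" for U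
      unfolding boundary_passage_bottom * by (subst sum.union_disjoint) auto
    moreover have "(\<Sum>k\<in>{K<..i}. X (k, 0)) \<le> (\<Sum>k\<in>{K<..i}. Y (k, 0))"
      using h by (intro sum_mono) auto
    ultimately show ?thesis by simp
  qed
  have left: "boundary_passage X 0 j \<le> max (?C 0 j) (?V 0 j)" for j
  proof (cases "j \<le> K")
    case True
    then have "boundary_passage X 0 j \<le> boundary_passage X 0 K"
      using v by (auto simp: boundary_passage_left intro!: sum_mono2)
    then show ?thesis using pos(1)[of K] by simp
  next
    case False
    then have *: "{1..j} = {1..K} \<union> {K<..j}" by auto
    have "boundary_passage U 0 j = boundary_passage U 0 K + (\<Sum>k\<in>{K<..j}. U (0, k))" for U
      unfolding boundary_passage_left * by (subst sum.union_disjoint) auto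
    moreover have "(\<Sum>k\<in>{K<..j}. X (0, k)) \<le> (\<Sum>k\<in>{K<..j}. Z (0, k))"
      using v by (intro sum_mono) auto
    ultimately show ?thesis by simp
  qed
  show ?thesis
  proof (induction "i + j" arbitrary: i j rule: less_induct)
    case less
    consider "j = 0" | "i = 0" | i' j' where "i = Suc i'" "j = Suc j'"
      by (cases i; cases j) auto
    then show ?case
    proof cases
      case 1 then show ?thesis using bottom[of i] by auto
    next
      case 2 then show ?thesis using left[of j] by auto
    next
      case 3
      note less[of i' j] less[of i j']
      moreover have "X (i, j) = W (i, j)" "Y (i, j) = W (i, j)" "Z (i, j) = W (i, j)"
        using int[of i j] 3 by auto
      ultimately show ?thesis using 3 by (auto simp: max_def split: if_splits)
    qed
  qed
qed

lemma passage_eq_left_plus_increments: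
  "boundary_passage X m n = (\<Sum>j\<in>{1..n}. X (0, j)) + (\<Sum>i\<in>{1..m}. boundary_passage X i n - boundary_passage X (i - 1) n)"
  by (induction m) (auto simp: boundary_passage_left sum.nat_ivl_Suc')

section \<open>The law of one cell\<close>

abbreviation exp_law :: "real \<Rightarrow> real measure" where
  "exp_law r \<equiv> density lborel (exponential_density r)"

lemma nn_integral_shift:
  fixes f :: "real \<Rightarrow> ennreal"
  assumes [measurable]: "f \<in> borel_measurable borel"
  shows "(\<integral>\<^sup>+x. f x \<partial>lborel) = (\<integral>\<^sup>+x. f (c + x) \<partial>lborel)"
  using nn_integral_real_affine[of f 1 c] by simp

lemma nn_integral_exponential_density:
  assumes "r > 0" shows "(\<integral>\<^sup>+x. exponential_density r x \<partial>lborel) = 1"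
proof -
  interpret prob_space "exp_law r" using assms by (rule prob_space_exponential_density)
  show ?thesis using emeasure_space_1 by (simp add: emeasure_density)
qed

text \<open>
  The map \<open>(u, v, w) \<mapsto> (u - v + w, w)\<close> carries the law of the triple, restricted to \<open>u - v \<in> S\<close>,
  to the law of the pair, restricted to \<open>x - y \<in> S\<close>. With \<open>u = v + d\<close> the density of the triple is the
  exponential density of rate \<open>p + q\<close> in \<open>v\<close> times a function of \<open>(d, w)\<close>; hence \<open>v\<close> integrates
  out, and a second shift \<open>x = w + d\<close> finishes. The set \<open>S\<close> will be \<open>{0<..}\<close> or \<open>{0..}\<close>, so
  that the two halves of the plane can be added without counting the diagonal twice.
\<close>
lemma exponential_cell_part:
  fixes h :: "real \<times> real \<Rightarrow> ennreal"
  assumes pq: "p > 0" "q > 0" and [measurable]: "S \<in> sets borel" and S: "S \<subseteq> {0..}"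
    and h[measurable]: "h \<in> borel_measurable (borel \<Otimes>\<^sub>M borel)"
  shows "(\<integral>\<^sup>+v. \<integral>\<^sup>+u. \<integral>\<^sup>+w. ennreal (exponential_density p u) * ennreal (exponential_density q v)
       * ennreal (exponential_density (p + q) w) * indicator S (u - v) * h (u - v + w, w) \<partial>lborel \<partial>lborel \<partial>lborel)
   = (\<integral>\<^sup>+y. \<integral>\<^sup>+x. ennreal (exponential_density p x) * ennreal (exponential_density q y) * indicator S (x - y) * h (x, y) \<partial>lborel \<partial>lborel)"
    (is "?L = ?R")
proof -
  let ?e = "\<lambda>r x. ennreal (exponential_density r x)"
  have density_eq: "?e p (v + t) * ?e q v * ?e (p + q) w = ?e (p + q) v * (?e p (w + t) * ?e q w)"
    if "t \<in> S" for v w t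
  proof -
    have "exponential_density p (v + t) * exponential_density q v * exponential_density (p + q) w
      = exponential_density (p + q) v * (exponential_density p (w + t) * exponential_density q w)"
      using that S by (auto simp: exponential_density_def exp_add[symmetric] algebra_simps)
    then show ?thesis using pq
      by (simp add: ennreal_mult[symmetric] exponential_density_nonneg)
  qed
  have density_eq': "?e p (v + t) * (?e q v * (?e (p + q) w * c)) = ?e (p + q) v * (?e p (w + t) * (?e q w * c))"
    if "t \<in> S" for v w t c
    using arg_cong[OF density_eq[OF that], of "\<lambda>x. x * c"] by (simp add: mult.assoc)
  have "?L = (\<integral>\<^sup>+v. \<integral>\<^sup>+t. \<integral>\<^sup>+w. ?e p (v + t) * ?e q v * ?e (p + q) w * indicator S t * h (t + w, w) \<partial>lborel \<partial>lborel \<partial>lborel)"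
    proof (rule nn_integral_cong, goal_cases)
    case (1 v)
    show ?case by (subst nn_integral_shift[where c = v]) auto
  qed
  also have "\<dots> = (\<integral>\<^sup>+v. \<integral>\<^sup>+t. \<integral>\<^sup>+w. ?e (p + q) v * (?e p (w + t) * ?e q w * indicator S t * h (t + w, w)) \<partial>lborel \<partial>lborel \<partial>lborel)"
    by (intro nn_integral_cong) (auto simp: density_eq' mult.assoc indicator_def)
  also have "\<dots> = (\<integral>\<^sup>+v. ?e (p + q) v * (\<integral>\<^sup>+t. \<integral>\<^sup>+w. ?e p (w + t) * ?e q w * indicator S t * h (t + w, w) \<partial>lborel \<partial>lborel) \<partial>lborel)"
    by (simp add: nn_integral_cmult)
  also have "\<dots> = (\<integral>\<^sup>+t. \<integral>\<^sup>+w. ?e p (w + t) * ?e q w * indicator S t * h (t + w, w) \<partial>lborel \<partial>lborel)"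
    using pq by (simp add: nn_integral_multc nn_integral_exponential_density)
  also have "\<dots> = (\<integral>\<^sup>+w. \<integral>\<^sup>+t. ?e p (w + t) * ?e q w * indicator S t * h (t + w, w) \<partial>lborel \<partial>lborel)"
    by (rule lborel_pair.Fubini') auto
  also have "\<dots> = ?R"
    proof (rule nn_integral_cong, goal_cases)
    case (1 w)
    show ?case by (subst (2) nn_integral_shift[where c = w]) (auto simp: add.commute)
  qed
  finally show ?thesis .
qed

text \<open>
  If the increments of the passage time along the bottom and left edges of a cell are \<open>u\<close> and \<open>v\<close>, and the
  weight of the cell is \<open>w\<close>, then the increments along the top and right edges are
  \<open>max 0 (u - v) + w\<close> and \<open>max 0 (v - u) + w\<close>. Splitting by \<open>u > v\<close> and \<open>u \<le> v\<close> reduces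
  the claim to two instances of the preceding computation, with the roles of the coordinates exchanged.
\<close>
lemma exponential_cell:
  fixes h :: "real \<times> real \<Rightarrow> ennreal"
  assumes pq: "p > 0" "q > 0" and h[measurable]: "h \<in> borel_measurable (borel \<Otimes>\<^sub>M borel)"
  shows "(\<integral>\<^sup>+u. \<integral>\<^sup>+v. \<integral>\<^sup>+w. h (max 0 (u - v) + w, max 0 (v - u) + w) \<partial>exp_law (p + q) \<partial>exp_law q \<partial>exp_law p)
    = (\<integral>\<^sup>+x. \<integral>\<^sup>+y. h (x, y) \<partial>exp_law q \<partial>exp_law p)"
    (is "?L = ?R")
proof -
  let ?e = "\<lambda>r x. ennreal (exponential_density r x)"
  let ?P = "{0<..} :: real set" and ?N = "{0..} :: real set"
  have "?L = (\<integral>\<^sup>+u. \<integral>\<^sup>+v. \<integral>\<^sup>+w. ?e p u * ?e q v * ?e (p + q) w * h (max 0 (u - v) + w, max 0 (v - u) + w) \<partial>lborel \<partial>lborel \<partial>lborel)"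
    by (simp add: nn_integral_density nn_integral_cmult[symmetric] mult.assoc)
  also have "\<dots> = (\<integral>\<^sup>+u. \<integral>\<^sup>+v. \<integral>\<^sup>+w.
       (?e p u * ?e q v * ?e (p + q) w * indicator ?P (u - v) * h (u - v + w, w)
      + ?e q v * ?e p u * ?e (q + p) w * indicator ?N (v - u) * h (w, v - u + w)) \<partial>lborel \<partial>lborel \<partial>lborel)"
    by (intro nn_integral_cong) (auto simp: indicator_def max_def add.commute mult.commute)
  also have "\<dots> = (\<integral>\<^sup>+u. \<integral>\<^sup>+v. \<integral>\<^sup>+w. ?e p u * ?e q v * ?e (p + q) w * indicator ?P (u - v) * h (u - v + w, w) \<partial>lborel \<partial>lborel \<partial>lborel)
      + (\<integral>\<^sup>+u. \<integral>\<^sup>+v. \<integral>\<^sup>+w. ?e q v * ?e p u * ?e (q + p) w * indicator ?N (v - u) * h (w, v - u + w) \<partial>lborel \<partial>lborel \<partial>lborel)"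
    by (simp add: nn_integral_add)
  also have "(\<integral>\<^sup>+u. \<integral>\<^sup>+v. \<integral>\<^sup>+w. ?e p u * ?e q v * ?e (p + q) w * indicator ?P (u - v) * h (u - v + w, w) \<partial>lborel \<partial>lborel \<partial>lborel)
     = (\<integral>\<^sup>+v. \<integral>\<^sup>+u. \<integral>\<^sup>+w. ?e p u * ?e q v * ?e (p + q) w * indicator ?P (u - v) * h (u - v + w, w) \<partial>lborel \<partial>lborel \<partial>lborel)"
    by (rule lborel_pair.Fubini') auto
  also have "\<dots> = (\<integral>\<^sup>+y. \<integral>\<^sup>+x. ?e p x * ?e q y * indicator ?P (x - y) * h (x, y) \<partial>lborel \<partial>lborel)"
    by (rule exponential_cell_part) (use pq in auto)
  also have "\<dots> = (\<integral>\<^sup>+x. \<integral>\<^sup>+y. ?e p x * ?e q y * indicator ?P (x - y) * h (x, y) \<partial>lborel \<partial>lborel)"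
    by (rule lborel_pair.Fubini') auto
  also have "(\<integral>\<^sup>+u. \<integral>\<^sup>+v. \<integral>\<^sup>+w. ?e q v * ?e p u * ?e (q + p) w * indicator ?N (v - u) * h (w, v - u + w) \<partial>lborel \<partial>lborel \<partial>lborel)
     = (\<integral>\<^sup>+x. \<integral>\<^sup>+y. ?e q y * ?e p x * indicator ?N (y - x) * h (x, y) \<partial>lborel \<partial>lborel)"
    using exponential_cell_part[of q p ?N "\<lambda>(x, y). h (y, x)"] pq by simp
  also have "(\<integral>\<^sup>+x. \<integral>\<^sup>+y. ?e p x * ?e q y * indicator ?P (x - y) * h (x, y) \<partial>lborel \<partial>lborel) + \<dots>
    = (\<integral>\<^sup>+x. \<integral>\<^sup>+y. (?e p x * ?e q y * indicator ?P (x - y) * h (x, y) + ?e q y * ?e p x * indicator ?N (y - x) * h (x, y)) \<partial>lborel \<partial>lborel)"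
    by (simp add: nn_integral_add)
  also have "\<dots> = (\<integral>\<^sup>+x. \<integral>\<^sup>+y. ?e p x * ?e q y * h (x, y) \<partial>lborel \<partial>lborel)"
    by (intro nn_integral_cong) (auto simp: indicator_def mult.commute)
  also have "\<dots> = ?R"
    by (simp add: nn_integral_density nn_integral_cmult[symmetric] mult.assoc)
  finally show ?thesis .
qed

section \<open>Burke property of the exponential grid\<close>

text \<open>
  Joint independence together with the exponential marginals; every step of the Burke
  argument transforms one such family into another with the same rates.
\<close>
definition (in prob_space) exponential_family :: "('i \<Rightarrow> 'a \<Rightarrow> real) \<Rightarrow> ('i \<Rightarrow> real) \<Rightarrow> 'i set \<Rightarrow> bool" where
  "exponential_family X r K \<longleftrightarrow> indep_vars (\<lambda>_. borel) X K \<and>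
     (\<forall>k\<in>K. distr M borel (X k) = exp_law (r k) \<and> r k > 0)"

context prob_space
begin

lemma exponential_familyD:
  assumes "exponential_family X r K"
  shows "indep_vars (\<lambda>_. borel) X K" "k \<in> K \<Longrightarrow> distr M borel (X k) = exp_law (r k)"
    "k \<in> K \<Longrightarrow> r k > 0" "k \<in> K \<Longrightarrow> X k \<in> borel_measurable M"
  using assms by (auto simp: exponential_family_def indep_vars_def)

lemma exponential_family_subset:
  assumes "exponential_family X r K" "L \<subseteq> K"
  shows "exponential_family X r L"
  using assms by (auto simp: exponential_family_def intro: indep_vars_subset)

lemma exponential_family_cong:
  assumes "\<And>k. k \<in> K \<Longrightarrow> X k = Y k" "\<And>k. k \<in> K \<Longrightarrow> r k = r' k"
  shows "exponential_family X r K \<longleftrightarrow> exponential_family Y r' K"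
proof -
  have "indep_vars (\<lambda>_. borel) X K \<longleftrightarrow> indep_vars (\<lambda>_. borel) Y K"
    using assms by (intro indep_vars_cong) auto
  then show ?thesis using assms by (simp add: exponential_family_def)
qed

lemma exponential_family_cell_law:
  assumes fam: "exponential_family X r K" and K: "{i, j, w} \<subseteq> K"
    and dist: "i \<noteq> j" "i \<noteq> w" "j \<noteq> w" and rate: "r w = r i + r j"
    and AB[measurable]: "A \<in> sets borel" "B \<in> sets borel"
  shows "emeasure M {\<omega> \<in> space M. max 0 (X i \<omega> - X j \<omega>) + X w \<omega> \<in> A \<and> max 0 (X j \<omega> - X i \<omega>) + X w \<omega> \<in> B}
    = emeasure (exp_law (r i)) A * emeasure (exp_law (r j)) B"
proof -
  have fam': "exponential_family X r {i, j, w}" using exponential_family_subset[OF fam K] .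
  note X = exponential_familyD[OF fam']
  have [measurable]: "X i \<in> borel_measurable M" "X j \<in> borel_measurable M" "X w \<in> borel_measurable M"
    using X(4) by auto
  have r: "r i > 0" "r j > 0" "r w > 0" using X(3) by auto
  \<comment> \<open>The rate 1 outside of the three indices only makes every factor a probability measure.\<close>
  define L where "L k = exp_law (if k \<in> {i, j, w} then r k else 1)" for k
  have L_ps: "prob_space (L k)" for k unfolding L_def using r by (intro prob_space_exponential_density) auto
  interpret L: product_prob_space L "{i, j, w}"
    by (rule product_prob_spaceI) (rule L_ps)
  have setsL[measurable_cong]: "sets (L k) = sets borel" for k by (simp add: L_def)
  have joint: "distr M (PiM {i, j, w} (\<lambda>_. borel)) (\<lambda>\<omega>. \<lambda>k\<in>{i, j, w}. X k \<omega>) = PiM {i, j, w} L"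
  proof -
    have "distr M (PiM {i, j, w} (\<lambda>_. borel)) (\<lambda>\<omega>. \<lambda>k\<in>{i, j, w}. X k \<omega>) = PiM {i, j, w} (\<lambda>k. distr M borel (X k))"
      by (rule iffD1[OF indep_vars_iff_distr_eq_PiM' X(1)]) (use X(4) in auto)
    also have "\<dots> = PiM {i, j, w} L"
      by (intro PiM_cong) (use X(2) in \<open>auto simp: L_def\<close>)
    finally show ?thesis .
  qed
  define h :: "real \<times> real \<Rightarrow> ennreal" where "h = indicator (A \<times> B)"
  have [measurable]: "h \<in> borel_measurable (borel \<Otimes>\<^sub>M borel)" unfolding h_def by measurable
  let ?g = "\<lambda>u v w. (max 0 (u - v) + w, max 0 (v - u) + w) :: real \<times> real"
  have "emeasure M {\<omega> \<in> space M. max 0 (X i \<omega> - X j \<omega>) + X w \<omega> \<in> A \<and> max 0 (X j \<omega> - X i \<omega>) + X w \<omega> \<in> B}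
    = (\<integral>\<^sup>+\<omega>. indicator {\<omega> \<in> space M. max 0 (X i \<omega> - X j \<omega>) + X w \<omega> \<in> A \<and> max 0 (X j \<omega> - X i \<omega>) + X w \<omega> \<in> B} \<omega> \<partial>M)"
    by (subst nn_integral_indicator) auto
  also have "\<dots> = (\<integral>\<^sup>+\<omega>. h (?g (X i \<omega>) (X j \<omega>) (X w \<omega>)) \<partial>M)"
    by (intro nn_integral_cong) (auto simp: indicator_def h_def)
  also have "\<dots> = (\<integral>\<^sup>+f. h (?g (f i) (f j) (f w)) \<partial>distr M (PiM {i, j, w} (\<lambda>_. borel)) (\<lambda>\<omega>. \<lambda>k\<in>{i, j, w}. X k \<omega>))"
    by (subst nn_integral_distr) (auto intro!: measurable_restrict X(4))
  also have "\<dots> = (\<integral>\<^sup>+f. h (?g (f i) (f j) (f w)) \<partial>PiM (insert i (insert j {w})) L)"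
    unfolding joint ..
  also have "\<dots> = (\<integral>\<^sup>+u. \<integral>\<^sup>+f. h (?g u (f j) (f w)) \<partial>PiM (insert j {w}) L \<partial>L i)"
    using dist by (subst L.product_nn_integral_insert_rev) (auto, measurable)
  also have "\<dots> = (\<integral>\<^sup>+u. \<integral>\<^sup>+v. \<integral>\<^sup>+f. h (?g u v (f w)) \<partial>PiM {w} L \<partial>L j \<partial>L i)"
    using dist by (subst L.product_nn_integral_insert_rev) (auto, measurable)
  also have "\<dots> = (\<integral>\<^sup>+u. \<integral>\<^sup>+v. \<integral>\<^sup>+x. h (?g u v x) \<partial>L w \<partial>L j \<partial>L i)"
    by (subst L.product_nn_integral_singleton) auto
  also have "\<dots> = (\<integral>\<^sup>+u. \<integral>\<^sup>+v. \<integral>\<^sup>+x. h (?g u v x) \<partial>exp_law (r i + r j) \<partial>exp_law (r j) \<partial>exp_law (r i))"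
    by (simp add: L_def rate)
  also have "\<dots> = (\<integral>\<^sup>+x. \<integral>\<^sup>+y. h (x, y) \<partial>exp_law (r j) \<partial>exp_law (r i))"
    by (rule exponential_cell) (use r in auto)
  also have "\<dots> = (\<integral>\<^sup>+x. \<integral>\<^sup>+y. indicator A x * indicator B y \<partial>exp_law (r j) \<partial>exp_law (r i))"
    by (intro nn_integral_cong) (auto simp: indicator_def h_def)
  also have "\<dots> = emeasure (exp_law (r i)) A * emeasure (exp_law (r j)) B"
    by (simp add: nn_integral_cmult nn_integral_multc)
  finally show ?thesis .
qed

text \<open>
  Burke property of one cell inside a larger independent family: the variables \<open>X i\<close>, \<open>X j\<close>, \<open>X w\<close> form
  a block that is independent of all others, and by the law of one cell the two outgoing increments are
  again independent with the rates of the incoming ones. The weight \<open>X w\<close> is used up.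
\<close>
lemma exponential_family_flip:
  assumes fam: "exponential_family X r K" and fin: "finite K" and K: "{i, j, w} \<subseteq> K"
    and dist: "i \<noteq> j" "i \<noteq> w" "j \<noteq> w" and rate: "r w = r i + r j"
  defines "Y \<equiv> X(i := \<lambda>\<omega>. max 0 (X i \<omega> - X j \<omega>) + X w \<omega>, j := \<lambda>\<omega>. max 0 (X j \<omega> - X i \<omega>) + X w \<omega>)"
  shows "exponential_family Y r (K - {w})"
proof -
  note X = exponential_familyD[OF fam]
  have [measurable]: "X i \<in> borel_measurable M" "X j \<in> borel_measurable M" "X w \<in> borel_measurable M"
    using X(4) K by auto
  have Ymeas: "Y k \<in> borel_measurable M" if "k \<in> K" for k
    using X(4)[OF that] by (auto simp: Y_def)
  have pair: "emeasure M {\<omega> \<in> space M. Y i \<omega> \<in> A \<and> Y j \<omega> \<in> B} = emeasure (exp_law (r i)) A * emeasure (exp_law (r j)) B"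
    if "A \<in> sets borel" "B \<in> sets borel" for A B
    using exponential_family_cell_law[OF fam K dist rate that] dist by (simp add: Y_def)
  have r: "r i > 0" "r j > 0" using X(3) K by auto
  interpret Ei: prob_space "exp_law (r i)" by (rule prob_space_exponential_density) fact
  interpret Ej: prob_space "exp_law (r j)" by (rule prob_space_exponential_density) fact
  have Yi: "distr M borel (Y i) = exp_law (r i)"
  proof (rule measure_eqI)
    fix A assume "A \<in> sets (distr M borel (Y i))"
    then show "emeasure (distr M borel (Y i)) A = emeasure (exp_law (r i)) A"
      using pair[of A UNIV] Ymeas[of i] K Ej.emeasure_space_1
      by (simp add: emeasure_distr vimage_def Int_def conj_commute)
  qed simp
  have Yj: "distr M borel (Y j) = exp_law (r j)"
  proof (rule measure_eqI)
    fix A assume "A \<in> sets (distr M borel (Y j))"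
    then show "emeasure (distr M borel (Y j)) A = emeasure (exp_law (r j)) A"
      using pair[of UNIV A] Ymeas[of j] K Ei.emeasure_space_1
      by (simp add: emeasure_distr vimage_def Int_def conj_commute)
  qed simp
  have laws: "distr M borel (Y k) = exp_law (r k)" if "k \<in> K - {w}" for k
    using Yi Yj X(2) that by (cases "k = i"; cases "k = j") (auto simp: Y_def)
  have pair_prob: "prob {\<omega> \<in> space M. Y i \<omega> \<in> A \<and> Y j \<omega> \<in> B} = prob (Y i -` A \<inter> space M) * prob (Y j -` B \<inter> space M)"
    if AB: "A \<in> sets borel" "B \<in> sets borel" for A B
  proof -
    have "emeasure (exp_law (r i)) A = emeasure M (Y i -` A \<inter> space M)"
      unfolding Yi[symmetric] using AB Ymeas[of i] K by (simp add: emeasure_distr)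
    moreover have "emeasure (exp_law (r j)) B = emeasure M (Y j -` B \<inter> space M)"
      unfolding Yj[symmetric] using AB Ymeas[of j] K by (simp add: emeasure_distr)
    ultimately show ?thesis using pair[OF AB] by (simp add: emeasure_eq_measure ennreal_mult[symmetric])
  qed
  define L where "L = K - {w, j}"
  \<comment> \<open>The three variables that interact form one block, labelled \<open>i\<close>; all others stay alone.\<close>
  define blk where "blk k = (if k = i then {i, j, w} else {k})" for k
  have L: "finite L" "i \<in> L" "K - {w} = insert j L" "j \<notin> L" using fin K dist by (auto simp: L_def)
  have blocks: "indep_vars (\<lambda>k. PiM (blk k) (\<lambda>_. borel)) (\<lambda>k \<omega>. restrict (\<lambda>l. X l \<omega>) (blk k)) L"
    by (rule indep_vars_restrict[OF X(1)])
       (use K dist in \<open>auto simp: L_def blk_def disjoint_family_on_def\<close>)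
  have "indep_vars (\<lambda>_. borel) Y (K - {w})"
  proof (subst indep_vars_finite[where E = "\<lambda>_. sets borel"])
    show "\<forall>A\<in>K - {w} \<rightarrow> sets borel. prob (\<Inter>k\<in>K - {w}. Y k -` A k \<inter> space M) = (\<Prod>k\<in>K - {w}. prob (Y k -` A k \<inter> space M))"
    proof
      fix A :: "'b \<Rightarrow> real set" assume A: "A \<in> K - {w} \<rightarrow> sets borel"
      then have [measurable]: "A i \<in> sets borel" "A j \<in> sets borel" using K dist by auto
      define D where "D k = (if k = i then {f \<in> space (PiM {i, j, w} (\<lambda>_. borel)).
           max 0 (f i - f j) + f w \<in> A i \<and> max 0 (f j - f i) + f w \<in> A j}
         else {f \<in> space (PiM {k} (\<lambda>_. borel)). f k \<in> A k})" for k
      have D: "D k \<in> sets (PiM (blk k) (\<lambda>_. borel))" if "k \<in> L" for k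
      proof (cases "k = i")
        case True then show ?thesis by (simp add: D_def blk_def)
      next
        case False
        then have [measurable]: "A k \<in> sets borel" using A that by (auto simp: L_def)
        show ?thesis using False by (simp add: D_def blk_def)
      qed
      have Di: "(\<lambda>\<omega>. restrict (\<lambda>l. X l \<omega>) (blk i)) -` D i \<inter> space M = {\<omega> \<in> space M. Y i \<omega> \<in> A i \<and> Y j \<omega> \<in> A j}"
        using dist by (auto simp: D_def blk_def Y_def space_PiM)
      have Dk: "(\<lambda>\<omega>. restrict (\<lambda>l. X l \<omega>) (blk k)) -` D k \<inter> space M = Y k -` A k \<inter> space M" if "k \<in> L - {i}" for k
        using that dist L by (auto simp: D_def blk_def Y_def space_PiM)
      have "prob (\<Inter>k\<in>L. (\<lambda>\<omega>. restrict (\<lambda>l. X l \<omega>) (blk k)) -` D k \<inter> space M)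
         = (\<Prod>k\<in>L. prob ((\<lambda>\<omega>. restrict (\<lambda>l. X l \<omega>) (blk k)) -` D k \<inter> space M))"
        by (rule indep_varsD_finite[OF blocks]) (use L D in auto)
      also have "(\<Inter>k\<in>L. (\<lambda>\<omega>. restrict (\<lambda>l. X l \<omega>) (blk k)) -` D k \<inter> space M) = (\<Inter>k\<in>K - {w}. Y k -` A k \<inter> space M)"
      proof -
        have "(\<Inter>k\<in>L. (\<lambda>\<omega>. restrict (\<lambda>l. X l \<omega>) (blk k)) -` D k \<inter> space M)
           = {\<omega> \<in> space M. Y i \<omega> \<in> A i \<and> Y j \<omega> \<in> A j} \<inter> (\<Inter>k\<in>L - {i}. Y k -` A k \<inter> space M)"
          using Di Dk L(2) by (subst insert_Diff[OF L(2), symmetric]) (simp add: INT_insert del: insert_Diff_single)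
        also have "\<dots> = (\<Inter>k\<in>insert j (insert i (L - {i})). Y k -` A k \<inter> space M)" by auto
        also have "insert j (insert i (L - {i})) = K - {w}" using L by auto
        finally show ?thesis .
      qed
      also have "(\<Prod>k\<in>L. prob ((\<lambda>\<omega>. restrict (\<lambda>l. X l \<omega>) (blk k)) -` D k \<inter> space M))
        = prob {\<omega> \<in> space M. Y i \<omega> \<in> A i \<and> Y j \<omega> \<in> A j} * (\<Prod>k\<in>L - {i}. prob (Y k -` A k \<inter> space M))"
        unfolding prod.remove[OF L(1,2)] Di by (simp add: Dk)
      also have "\<dots> = (\<Prod>k\<in>K - {w}. prob (Y k -` A k \<inter> space M))"
        using L by (simp add: pair_prob prod.remove[OF L(1,2)] mult_ac)
      finally show "prob (\<Inter>k\<in>K - {w}. Y k -` A k \<inter> space M) = (\<Prod>k\<in>K - {w}. prob (Y k -` A k \<inter> space M))" .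
    qed
  qed (use L Ymeas fin in \<open>auto simp: Int_stable_def sets.sigma_sets_eq[of borel, simplified]\<close>)
  then show ?thesis using laws X(3) by (auto simp: exponential_family_def)
qed

end

lemma (in prob_space) exponential_family_distributed:
  assumes "exponential_family X r K" "k \<in> K"
  shows "distributed M lborel (X k) (exponential_density (r k))"
proof -
  have "distr M lborel (X k) = distr M borel (X k)" by (intro distr_cong) auto
  then show ?thesis using exponential_familyD(2,4)[OF assms(1)] assms(2) by (auto simp: distributed_def)
qed

lemma (in prob_space) exponential_family_divide:
  assumes fam: "exponential_family X r K" and c: "\<And>k. k \<in> K \<Longrightarrow> c k > 0"
  shows "exponential_family (\<lambda>k \<omega>. X k \<omega> / c k) (\<lambda>k. r k * c k) K"
proof -
  note X = exponential_familyD[OF fam]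
  have "indep_vars (\<lambda>_. borel) (\<lambda>k \<omega>. X k \<omega> / c k) K"
    by (rule indep_vars_compose2[OF X(1)]) auto
  moreover have "distr M borel (\<lambda>\<omega>. X k \<omega> / c k) = exp_law (r k * c k)" if k: "k \<in> K" for k
  proof -
    have r: "0 < r k" "0 < c k" using X(3)[OF k] c[OF k] by auto
    have "distributed M lborel (\<lambda>\<omega>. X k \<omega> / c k) (exponential_density (r k * c k))"
    proof (subst exponential_distributed_iff)
      have "\<P>(x in M. X k x / c k \<le> a) = 1 - exp (- a * (r k * c k))" if "0 \<le> a" for a
        using exponential_distributedD_le[OF exponential_family_distributed[OF fam k], of "a * c k"] r that
        by (simp add: pos_divide_le_eq mult_ac)
      then show "(\<lambda>\<omega>. X k \<omega> / c k) \<in> borel_measurable M \<and> (\<forall>a\<ge>0. \<P>(x in M. X k x / c k \<le> a) = 1 - exp (- a * (r k * c k)))"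
        using X(4)[OF k] by auto
    qed (use r in simp)
    then have "distr M lborel (\<lambda>\<omega>. X k \<omega> / c k) = exp_law (r k * c k)" by (simp add: distributed_def)
    moreover have "distr M lborel (\<lambda>\<omega>. X k \<omega> / c k) = distr M borel (\<lambda>\<omega>. X k \<omega> / c k)" by (intro distr_cong) auto
    ultimately show ?thesis by simp
  qed
  ultimately show ?thesis using X(3) c by (auto simp: exponential_family_def)
qed

lemma (in prob_space) exponential_family_nonneg:
  fixes X :: "'i::countable \<Rightarrow> 'a \<Rightarrow> real"
  assumes "exponential_family X r K"
  shows "AE \<omega> in M. \<forall>k\<in>K. 0 \<le> X k \<omega>"
proof -
  have "AE \<omega> in M. 0 \<le> X k \<omega>" if k: "k \<in> K" for k
    by (subst distributed_AE2[OF exponential_family_distributed[OF assms k]]) (auto simp: exponential_density_def)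
  then show ?thesis by (subst AE_ball_countable) auto
qed

context prob_space begin

text \<open>
  Cells are processed row by row, from left to right. At each moment the increments along the
  down-right path separating processed from unprocessed cells, together with the unprocessed weights, form an
  independent exponential family; processing the next cell is a flip. The path increment in
  column \<open>k\<close> is stored at index \<open>(k, 0)\<close> and the one in row \<open>l\<close> at index \<open>(0, l)\<close>, so that
  the rate of every index stays \<open>\<alpha> k + \<beta> l\<close> throughout, and \<open>\<alpha> 0 + \<beta> 0 = 0\<close> makes
  the rate of the cell weight the sum of the two incoming rates.
\<close>
lemma passage_increments_exponential:
  fixes X :: "nat \<times> nat \<Rightarrow> 'a \<Rightarrow> real" and \<alpha> \<beta> :: "nat \<Rightarrow> real"
  assumes fam: "exponential_family X (\<lambda>(i, j). \<alpha> i + \<beta> j) ({0..m} \<times> {0..n} - {(0, 0)})"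
    and zero: "\<alpha> 0 + \<beta> 0 = 0"
  defines "G \<equiv> \<lambda>i j \<omega>. boundary_passage (\<lambda>k. X k \<omega>) i j"
  shows "exponential_family (\<lambda>(i, j) \<omega>. G i n \<omega> - G (i - 1) n \<omega>) (\<lambda>(i, j). \<alpha> i + \<beta> j) ({1..m} \<times> {0})"
proof -
  define R where "R = (\<lambda>(i, j). \<alpha> i + \<beta> j)"
  define H where "H i j \<omega> = G i j \<omega> - G (i - 1) j \<omega>" for i j \<omega>
  define V where "V i j \<omega> = G i (Suc j) \<omega> - G i j \<omega>" for i j \<omega>
  \<comment> \<open>The index set after rows \<open>1, ..., j\<close> are processed; the left boundary weights of these rows are used up.\<close>
  define T where "T j = {1..m} \<times> {0} \<union> {0..m} \<times> {j<..n}" for j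
  have row: "exponential_family (\<lambda>(k, l). if l = 0 then H k j else X (k, l)) R (T j)" if "j \<le> n" for j
    using that
  proof (induction j)
    case 0
    have "T 0 = {0..m} \<times> {0..n} - {(0, 0)}" by (auto simp: T_def)
    moreover have "exponential_family (\<lambda>(k, l). if l = 0 then H k 0 else X (k, l)) R ({0..m} \<times> {0..n} - {(0, 0)})
       \<longleftrightarrow> exponential_family X R ({0..m} \<times> {0..n} - {(0, 0)})"
    proof (rule exponential_family_cong)
      fix kl assume kl: "kl \<in> {0..m} \<times> {0..n} - {(0, 0)}"
      have "H (Suc k) 0 = X (Suc k, 0)" for k by (auto simp: H_def G_def fun_eq_iff)
      then show "(case kl of (k, l) \<Rightarrow> if l = 0 then H k 0 else X (k, l)) = X kl"
        using kl by (cases kl; cases "fst kl") auto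
    qed simp
    ultimately show ?case using fam by (simp add: R_def)
  next
    case (Suc j)
    define Z where "Z i = (\<lambda>(k, l). if l = 0 then if k \<le> i then H k (Suc j) else H k j
        else if k = 0 \<and> l = Suc j then V i j else X (k, l))" for i
    \<comment> \<open>The index set after the first \<open>i\<close> cells of row \<open>Suc j\<close> are processed.\<close>
    define S where "S i = T j - {1..i} \<times> {Suc j}" for i
    have "exponential_family (Z i) R (S i)" if "i \<le> m" for i
      using that
    proof (induction i)
      case 0
      have "exponential_family (Z 0) R (S 0) \<longleftrightarrow> exponential_family (\<lambda>(k, l). if l = 0 then H k j else X (k, l)) R (T j)"
      proof -
        have "S 0 = T j" by (simp add: S_def)
        moreover have "exponential_family (Z 0) R (T j) \<longleftrightarrow> exponential_family (\<lambda>(k, l). if l = 0 then H k j else X (k, l)) R (T j)"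
          by (rule exponential_family_cong) (auto simp: Z_def T_def V_def G_def fun_eq_iff)
        ultimately show ?thesis by simp
      qed
      then show ?case using Suc by simp
    next
      case (Suc i)
      let ?I = "(Suc i, 0)" and ?J = "(0, Suc j)" and ?W = "(Suc i, Suc j)"
      let ?Z = "(Z i)(?I := \<lambda>\<omega>. max 0 (Z i ?I \<omega> - Z i ?J \<omega>) + Z i ?W \<omega>, ?J := \<lambda>\<omega>. max 0 (Z i ?J \<omega> - Z i ?I \<omega>) + Z i ?W \<omega>)"
      have "exponential_family ?Z R (S i - {?W})"
      proof (rule exponential_family_flip)
        show "exponential_family (Z i) R (S i)" using Suc by simp
        show "finite (S i)" by (simp add: S_def T_def)
        show "{?I, ?J, ?W} \<subseteq> S i" using Suc.prems \<open>Suc j \<le> n\<close> by (auto simp: S_def T_def)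
        show "R ?W = R ?I + R ?J" using zero by (simp add: R_def)
      qed auto
      also have "S i - {?W} = S (Suc i)" by (auto simp: S_def)
      also have "exponential_family ?Z R (S (Suc i)) \<longleftrightarrow> exponential_family (Z (Suc i)) R (S (Suc i))"
      proof (rule exponential_family_cong)
        fix k assume "k \<in> S (Suc i)"
        have "Z i ?I = H (Suc i) j" "Z i ?J = V i j" "Z i ?W = X ?W" by (auto simp: Z_def)
        moreover have "max 0 (H (Suc i) j \<omega> - V i j \<omega>) + X ?W \<omega> = H (Suc i) (Suc j) \<omega>"
          "max 0 (V i j \<omega> - H (Suc i) j \<omega>) + X ?W \<omega> = V (Suc i) j \<omega>" for \<omega>
          by (auto simp: H_def V_def G_def max_def)
        ultimately show "?Z k = Z (Suc i) k"
          by (cases k) (auto simp: Z_def fun_eq_iff le_Suc_eq)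
      qed simp
      finally show ?case .
    qed
    from this[of m] have "exponential_family (Z m) R (T (Suc j))"
      by (rule exponential_family_subset) (auto simp: S_def T_def)
    also have "?this \<longleftrightarrow> ?case"
      by (rule exponential_family_cong) (auto simp: Z_def T_def)
    finally show ?case .
  qed
  have "exponential_family (\<lambda>(k, l). if l = 0 then H k n else X (k, l)) R ({1..m} \<times> {0})"
    by (rule exponential_family_subset[OF row[OF order_refl]]) (auto simp: T_def)
  also have "?this \<longleftrightarrow> ?thesis" unfolding R_def
    by (rule exponential_family_cong) (auto simp: H_def fun_eq_iff)
  finally show ?thesis .
qed

end

section \<open>Law of large numbers for exponential arrays\<close>

context prob_space begin

lemma exponential_family_sum_variance:
  assumes fam: "exponential_family X r K" and fin: "finite K" and rho: "\<rho> > 0" "\<And>k. k \<in> K \<Longrightarrow> \<rho> \<le> r k"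
  shows "(\<integral>\<^sup>+\<omega>. ennreal (((\<Sum>k\<in>K. X k \<omega>) - (\<Sum>k\<in>K. 1 / r k))\<^sup>2) \<partial>M) \<le> ennreal (real (card K) / \<rho>\<^sup>2)"
proof -
  note X = exponential_familyD[OF fam]
  define Y where "Y k \<omega> = X k \<omega> - 1 / r k" for k \<omega>
  note dist = exponential_family_distributed[OF fam]
  have meas[measurable]: "Y k \<in> borel_measurable M" if "k \<in> K" for k
    using X(4)[OF that] unfolding Y_def by measurable
  have int2: "integrable M (\<lambda>\<omega>. (X k \<omega>)\<^sup>2)" if "k \<in> K" for k
    using erlang_ith_moment_integrable[OF X(3)[OF that] dist[OF that], of 2] .
  have intX: "integrable M (X k)" if "k \<in> K" for k
    using square_integrable_imp_integrable[OF X(4)[OF that] int2[OF that]] .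
  have intY: "integrable M (Y k)" if "k \<in> K" for k
    using intX[OF that] unfolding Y_def by simp
  have EY: "expectation (Y k) = 0" if "k \<in> K" for k
    using intX[OF that] exponential_distributed_expectation[OF X(3)[OF that] dist[OF that]]
    unfolding Y_def by (simp add: prob_space)
  have intY2: "integrable M (\<lambda>\<omega>. Y k \<omega> * Y k \<omega>)" if "k \<in> K" for k
  proof -
    have "(\<lambda>\<omega>. Y k \<omega> * Y k \<omega>) = (\<lambda>\<omega>. (X k \<omega>)\<^sup>2 - 2 / r k * X k \<omega> + 1 / (r k)\<^sup>2)"
      by (simp add: Y_def fun_eq_iff power2_eq_square algebra_simps)
    then show ?thesis using int2[OF that] intX[OF that] by simp
  qed
  have EY2: "expectation (\<lambda>\<omega>. Y k \<omega> * Y k \<omega>) = 1 / (r k)\<^sup>2" if "k \<in> K" for k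
    using exponential_distributed_variance[OF X(3)[OF that] dist[OF that]]
      exponential_distributed_expectation[OF X(3)[OF that] dist[OF that]]
    by (simp add: Y_def power2_eq_square)
  have indY: "indep_vars (\<lambda>_. borel) Y K"
    unfolding Y_def by (rule indep_vars_compose2[OF X(1)]) auto
  have cross: "integrable M (\<lambda>\<omega>. Y k \<omega> * Y l \<omega>) \<and> expectation (\<lambda>\<omega>. Y k \<omega> * Y l \<omega>) = 0"
    if "k \<in> K" "l \<in> K" "k \<noteq> l" for k l
  proof -
    have "indep_vars (\<lambda>_. borel) Y {k, l}"
      by (rule indep_vars_subset[OF indY]) (use that in auto)
    from indep_vars_lebesgue_integral[OF _ this] indep_vars_integrable[OF _ this]
    show ?thesis using that intY EY by auto
  qed
  have int: "integrable M (\<lambda>\<omega>. Y k \<omega> * Y l \<omega>)" if "k \<in> K" "l \<in> K" for k l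
    using cross intY2 that by (cases "k = l") auto
  \<comment> \<open>Only the diagonal terms of this double sum have nonzero expectation.\<close>
  have sq: "((\<Sum>k\<in>K. X k \<omega>) - (\<Sum>k\<in>K. 1 / r k))\<^sup>2 = (\<Sum>k\<in>K. \<Sum>l\<in>K. Y k \<omega> * Y l \<omega>)" for \<omega>
    by (simp add: Y_def sum_subtractf[symmetric] power2_eq_square sum_product)
  have "expectation (\<lambda>\<omega>. \<Sum>k\<in>K. \<Sum>l\<in>K. Y k \<omega> * Y l \<omega>) = (\<Sum>k\<in>K. \<Sum>l\<in>K. expectation (\<lambda>\<omega>. Y k \<omega> * Y l \<omega>))"
    using int by (simp add: Bochner_Integration.integral_sum)
  also have "\<dots> = (\<Sum>k\<in>K. \<Sum>l\<in>K. if l = k then 1 / (r k)\<^sup>2 else 0)"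
    using cross EY2 by (intro sum.cong) auto
  also have "\<dots> = (\<Sum>k\<in>K. 1 / (r k)\<^sup>2)"
    using fin by simp
  also have "\<dots> \<le> (\<Sum>k\<in>K. 1 / \<rho>\<^sup>2)"
    using rho by (intro sum_mono divide_left_mono power_mono) (auto intro!: mult_pos_pos zero_less_power dest: less_le_trans)
  finally have *: "expectation (\<lambda>\<omega>. \<Sum>k\<in>K. \<Sum>l\<in>K. Y k \<omega> * Y l \<omega>) \<le> real (card K) / \<rho>\<^sup>2" by simp
  have "(\<integral>\<^sup>+\<omega>. ennreal (((\<Sum>k\<in>K. X k \<omega>) - (\<Sum>k\<in>K. 1 / r k))\<^sup>2) \<partial>M)
     = ennreal (expectation (\<lambda>\<omega>. ((\<Sum>k\<in>K. X k \<omega>) - (\<Sum>k\<in>K. 1 / r k))\<^sup>2))"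
  proof (rule nn_integral_eq_integral)
    show "integrable M (\<lambda>\<omega>. ((\<Sum>k\<in>K. X k \<omega>) - (\<Sum>k\<in>K. 1 / r k))\<^sup>2)"
      unfolding sq using int by (intro Bochner_Integration.integrable_sum)
  qed simp
  then show ?thesis using * by (simp add: sq ennreal_leI)
qed

text \<open>
  The expectation of \<open>\<Sum>n. (D n)\<^sup>2\<close> is finite, so the series converges almost surely.
\<close>
lemma tendsto_0_AE_of_summable_second_moments:
  fixes D :: "nat \<Rightarrow> 'a \<Rightarrow> real"
  assumes meas[measurable]: "\<And>n. D n \<in> borel_measurable M"
    and bound: "\<And>n. (\<integral>\<^sup>+\<omega>. ennreal ((D n \<omega>)\<^sup>2) \<partial>M) \<le> ennreal (b n)" and b: "summable b" "\<And>n. 0 \<le> b n"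
  shows "AE \<omega> in M. (\<lambda>n. D n \<omega>) \<longlonglongrightarrow> 0"
proof -
  have "(\<integral>\<^sup>+\<omega>. (\<Sum>n. ennreal ((D n \<omega>)\<^sup>2)) \<partial>M) = (\<Sum>n. \<integral>\<^sup>+\<omega>. ennreal ((D n \<omega>)\<^sup>2) \<partial>M)"
    by (rule nn_integral_suminf) simp
  also have "\<dots> \<le> (\<Sum>n. ennreal (b n))"
    by (intro suminf_le bound) auto
  also have "\<dots> < \<infinity>"
    using b by (simp add: suminf_ennreal2 less_top[symmetric])
  finally have "AE \<omega> in M. (\<Sum>n. ennreal ((D n \<omega>)\<^sup>2)) \<noteq> \<infinity>"
    by (intro nn_integral_noteq_infinite) auto
  then show ?thesis
  proof eventually_elim
    case (elim \<omega>)
    then have "summable (\<lambda>n. (D n \<omega>)\<^sup>2)" by (intro summable_suminf_not_top) auto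
    from summable_LIMSEQ_zero[OF this] show ?case by (simp add: tendsto_null_power)
  qed
qed

text \<open>
  The variance of the sum is at most \<open>c * n\<^sup>2 / \<rho>\<^sup>2\<close>, so after division by \<open>n\<^sup>2\<close> the second moments are of
  order \<open>1 / n\<^sup>2\<close> and summable. The family may change completely with \<open>n\<close>; this
  matters for the increments along the row \<open>n\<close>.
\<close>
lemma exponential_family_strong_law:
  assumes fam: "\<And>n. exponential_family (X n) (r n) (K n)" and fin: "\<And>n. finite (K n)"
    and rho: "\<rho> > 0" "\<And>n k. k \<in> K n \<Longrightarrow> \<rho> \<le> r n k"
    and card: "\<And>n. real (card (K n)) \<le> c * real n ^ 2"
  shows "AE \<omega> in M. (\<lambda>n. ((\<Sum>k\<in>K n. X n k \<omega>) - (\<Sum>k\<in>K n. 1 / r n k)) / real n ^ 2) \<longlonglongrightarrow> 0"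
proof (rule tendsto_0_AE_of_summable_second_moments)
  have c: "0 \<le> c" using card[of 1] by (simp add: order_trans[OF of_nat_0_le_iff])
  show "(\<lambda>\<omega>. ((\<Sum>k\<in>K n. X n k \<omega>) - (\<Sum>k\<in>K n. 1 / r n k)) / real n ^ 2) \<in> borel_measurable M" for n
    using exponential_familyD(4)[OF fam[of n]] by measurable
  show "summable (\<lambda>n. c / \<rho>\<^sup>2 * (1 / real n ^ 2))"
    by (intro summable_mult) (use inverse_power_summable[of 2, where 'a = real] in \<open>simp add: inverse_eq_divide\<close>)
  show "0 \<le> c / \<rho>\<^sup>2 * (1 / real n ^ 2)" for n using c by simp
  show "(\<integral>\<^sup>+\<omega>. ennreal ((((\<Sum>k\<in>K n. X n k \<omega>) - (\<Sum>k\<in>K n. 1 / r n k)) / real n ^ 2)\<^sup>2) \<partial>M) \<le> ennreal (c / \<rho>\<^sup>2 * (1 / real n ^ 2))" for n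
  proof -
    have meas[measurable]: "(\<lambda>\<omega>. \<Sum>k\<in>K n. X n k \<omega>) \<in> borel_measurable M"
      using exponential_familyD(4)[OF fam[of n]] by measurable
    have "(\<integral>\<^sup>+\<omega>. ennreal ((((\<Sum>k\<in>K n. X n k \<omega>) - (\<Sum>k\<in>K n. 1 / r n k)) / real n ^ 2)\<^sup>2) \<partial>M)
      = (\<integral>\<^sup>+\<omega>. ennreal (1 / real n ^ 4) * ennreal (((\<Sum>k\<in>K n. X n k \<omega>) - (\<Sum>k\<in>K n. 1 / r n k))\<^sup>2) \<partial>M)"
      by (intro nn_integral_cong) (simp add: power_divide ennreal_mult[symmetric])
    also have "\<dots> = ennreal (1 / real n ^ 4) * (\<integral>\<^sup>+\<omega>. ennreal (((\<Sum>k\<in>K n. X n k \<omega>) - (\<Sum>k\<in>K n. 1 / r n k))\<^sup>2) \<partial>M)"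
      by (rule nn_integral_cmult) measurable
    also have "\<dots> \<le> ennreal (1 / real n ^ 4) * ennreal (real (card (K n)) / \<rho>\<^sup>2)"
      by (intro mult_left_mono exponential_family_sum_variance fam fin rho) auto
    also have "\<dots> = ennreal (1 / real n ^ 4 * (real (card (K n)) / \<rho>\<^sup>2))"
      by (rule ennreal_mult[symmetric]) auto
    also have "\<dots> \<le> ennreal (1 / real n ^ 4 * (c * real n ^ 2 / \<rho>\<^sup>2))"
      by (intro ennreal_leI mult_left_mono divide_right_mono card) auto
    also have "1 / real n ^ 4 * (c * real n ^ 2 / \<rho>\<^sup>2) = c / \<rho>\<^sup>2 * (1 / real n ^ 2)"
      by (cases "n = 0") (simp_all add: field_simps power2_eq_square power4_eq_xxxx)
    finally show ?thesis .
  qed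
qed

end

lemma (in prob_space) exponential_family_sum_limit:
  assumes fam: "\<And>n. exponential_family (X n) (r n) (K n)" and fin: "\<And>n. finite (K n)"
    and rho: "\<rho> > 0" "\<And>n k. k \<in> K n \<Longrightarrow> \<rho> \<le> r n k"
    and card: "\<And>n. real (card (K n)) \<le> c * real n ^ 2"
    and L: "(\<lambda>n. (\<Sum>k\<in>K n. 1 / r n k) / real (n\<^sup>2)) \<longlonglongrightarrow> L"
  shows "AE \<omega> in M. (\<lambda>n. (\<Sum>k\<in>K n. X n k \<omega>) / real (n\<^sup>2)) \<longlonglongrightarrow> L"
proof -
  have "AE \<omega> in M. (\<lambda>n. ((\<Sum>k\<in>K n. X n k \<omega>) - (\<Sum>k\<in>K n. 1 / r n k)) / real n ^ 2) \<longlonglongrightarrow> 0"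
    by (rule exponential_family_strong_law[OF fam fin rho(1) _ card]) (rule rho(2))
  then show ?thesis
  proof eventually_elim
    case (elim \<omega>)
    from tendsto_add[OF elim L] show ?case by (simp add: diff_divide_distrib)
  qed
qed

lemma filterlim_square_at_top: "filterlim (\<lambda>n::nat. n\<^sup>2) at_top sequentially"
  by (rule filterlim_at_top_mono[OF filterlim_ident]) (auto simp: power2_eq_square)

text \<open>
  Positivity of \<open>x\<close> forces \<open>p n\<close> to tend to infinity, so the averages can be evaluated along \<open>p\<close>.
\<close>
lemma averages_along:
  fixes f :: "nat \<Rightarrow> real" and p :: "nat \<Rightarrow> nat"
  assumes f: "(\<lambda>n. f n / real n) \<longlonglongrightarrow> A" and p: "(\<lambda>n. real (p n) / real (n\<^sup>2)) \<longlonglongrightarrow> x" and x: "x > 0"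
  shows "(\<lambda>n. f (p n) / real (n\<^sup>2)) \<longlonglongrightarrow> x * A"
proof -
  have sq: "filterlim (\<lambda>n. real (n\<^sup>2)) at_top sequentially"
    by (rule filterlim_compose[OF filterlim_real_sequentially]) (rule filterlim_square_at_top)
  have "filterlim (\<lambda>n. real (p n) / real (n\<^sup>2) * real (n\<^sup>2)) at_top sequentially"
    by (rule filterlim_tendsto_pos_mult_at_top[OF p x sq])
  then have "filterlim (\<lambda>n. real (p n)) at_top sequentially"
  proof (rule filterlim_mono_eventually[OF _ order_refl order_refl])
    show "eventually (\<lambda>n. real (p n) / real (n\<^sup>2) * real (n\<^sup>2) = real (p n)) sequentially"
      using eventually_gt_at_top[of 0] by eventually_elim auto
  qed
  then have p_top: "filterlim p at_top sequentially"
    by (simp add: filterlim_sequentially_iff_filterlim_real)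
  have "(\<lambda>n. (real (p n) / real (n\<^sup>2)) * (f (p n) / real (p n))) \<longlonglongrightarrow> x * A"
    by (intro tendsto_mult p filterlim_compose[OF f p_top])
  moreover have "eventually (\<lambda>n. (real (p n) / real (n\<^sup>2)) * (f (p n) / real (p n)) = f (p n) / real (n\<^sup>2)) sequentially"
    using p_top[unfolded filterlim_at_top, rule_format, of 1] by eventually_elim auto
  ultimately show ?thesis by (rule Lim_transform_eventually)
qed

lemma floor_ratio_limit:
  assumes "x > 0"
  shows "(\<lambda>n. real (nat \<lfloor>real (n\<^sup>2) * x\<rfloor>) / real (n\<^sup>2)) \<longlonglongrightarrow> x"
proof (rule tendsto_sandwich)
  show "eventually (\<lambda>n. x - 1 / real (n\<^sup>2) \<le> real (nat \<lfloor>real (n\<^sup>2) * x\<rfloor>) / real (n\<^sup>2)) sequentially"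
    using eventually_gt_at_top[of 0]
  proof eventually_elim
    case (elim n)
    have "real (n\<^sup>2) * x - 1 \<le> real (nat \<lfloor>real (n\<^sup>2) * x\<rfloor>)" by linarith
    from divide_right_mono[OF this, of "real (n\<^sup>2)"] elim show ?case by (simp add: diff_divide_distrib)
  qed
  show "eventually (\<lambda>n. real (nat \<lfloor>real (n\<^sup>2) * x\<rfloor>) / real (n\<^sup>2) \<le> x) sequentially"
    using eventually_gt_at_top[of 0]
  proof eventually_elim
    case (elim n)
    have "real (nat \<lfloor>real (n\<^sup>2) * x\<rfloor>) \<le> real (n\<^sup>2) * x" using assms by (simp add: of_nat_floor)
    from divide_right_mono[OF this, of "real (n\<^sup>2)"] elim show ?case by simp
  qed
  have "(\<lambda>n. 1 / real n * (1 / real n)) \<longlonglongrightarrow> 0 * 0" by (intro tendsto_mult lim_const_over_n)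
  then have "(\<lambda>n. x - 1 / real (n\<^sup>2)) \<longlonglongrightarrow> x - 0" by (intro tendsto_diff tendsto_const) (simp add: power2_eq_square)
  then show "(\<lambda>n. x - 1 / real (n\<^sup>2)) \<longlonglongrightarrow> x" by simp
qed auto

section \<open>Tilted boundaries in a fixed environment\<close>

text \<open>
  The variables on the axes have rate \<open>1\<close>, so that dividing them by \<open>a i + z\<close> and \<open>b j - z\<close> yields
  the boundary weights of every tilt \<open>z\<close> at once. This couples all tilts.
\<close>
locale exponential_passage = prob_space M for M :: "'a measure" +
  fixes X :: "nat \<times> nat \<Rightarrow> 'a \<Rightarrow> real" and a b :: "nat \<Rightarrow> real" and c :: real
  assumes a_ge: "i \<ge> 1 \<Longrightarrow> c \<le> a i" and b_ge: "j \<ge> 1 \<Longrightarrow> c \<le> b j"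
    and weights: "exponential_family X (\<lambda>(i, j). if i = 0 \<or> j = 0 then 1 else a i + b j) UNIV"
begin

text \<open>
  Division turns rate \<open>1\<close> into the rate of the boundary weight. The value at the
  origin, where the divisor \<open>a 0 + z\<close> is arbitrary, is a dummy because the origin carries no weight.
\<close>
definition tilted :: "real \<Rightarrow> nat \<times> nat \<Rightarrow> 'a \<Rightarrow> real" where
  "tilted z k \<omega> = X k \<omega> / (case k of (i, j) \<Rightarrow> if j = 0 then a i + z else if i = 0 then b j - z else 1)"

lemma tilted_simps:
  "i \<ge> 1 \<Longrightarrow> tilted z (i, 0) \<omega> = X (i, 0) \<omega> / (a i + z)"
  "j \<ge> 1 \<Longrightarrow> tilted z (0, j) \<omega> = X (0, j) \<omega> / (b j - z)"
  "i \<ge> 1 \<Longrightarrow> j \<ge> 1 \<Longrightarrow> tilted z (i, j) \<omega> = X (i, j) \<omega>"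
  by (auto simp: tilted_def)

text \<open>
  The rates are written as a sum of a function of \<open>i\<close> and a function of \<open>j\<close>, with the values \<open>- z\<close>
  and \<open>z\<close> at \<open>0\<close>; this is the form in which the Burke property applies.
\<close>
lemma tilted_family:
  assumes z: "\<bar>z\<bar> < c"
  shows "exponential_family (tilted z) (\<lambda>(i, j). (if i = 0 then - z else a i) + (if j = 0 then z else b j)) (UNIV - {(0, 0)})"
proof -
  let ?d = "\<lambda>(i, j). if j = 0 then a i + z else if i = 0 then b j - z else 1"
  have "exponential_family X (\<lambda>(i, j). if i = 0 \<or> j = 0 then 1 else a i + b j) (UNIV - {(0, 0)})"
    by (rule exponential_family_subset[OF weights]) auto
  then have "exponential_family (\<lambda>k \<omega>. X k \<omega> / ?d k) (\<lambda>k. (\<lambda>(i, j). if i = 0 \<or> j = 0 then 1 else a i + b j) k * ?d k) (UNIV - {(0, 0)})"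
  proof (rule exponential_family_divide)
    fix k :: "nat \<times> nat" assume "k \<in> UNIV - {(0, 0)}"
    then show "0 < ?d k" using a_ge[of "fst k"] b_ge[of "snd k"] z by (cases k) auto
  qed
  also have "?this \<longleftrightarrow> ?thesis"
  proof (rule exponential_family_cong)
    fix k :: "nat \<times> nat" assume "k \<in> UNIV - {(0, 0)}"
    then show "(case k of (i, j) \<Rightarrow> if i = 0 \<or> j = 0 then 1 else a i + b j) * ?d k
      = (case k of (i, j) \<Rightarrow> (if i = 0 then - z else a i) + (if j = 0 then z else b j))"
      by (cases k; cases "fst k = 0"; cases "snd k = 0") auto
  qed (simp add: tilted_def fun_eq_iff)
  finally show ?thesis .
qed

lemma tilted_nonneg:
  assumes z: "\<bar>z\<bar> < c"
  shows "AE \<omega> in M. \<forall>k\<in>UNIV - {(0, 0)}. 0 \<le> tilted z k \<omega>"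
  by (rule exponential_family_nonneg[OF tilted_family[OF z]])

lemma bottom_rate_sum:
  "(\<Sum>k\<in>{1..m} \<times> {0}. 1 / (case k of (i, j) \<Rightarrow> (if i = 0 then - z else a i) + (if j = 0 then z else b j)))
    = (\<Sum>i\<in>{1..m}. 1 / (a i + z))"
  unfolding sum.cartesian_product' by (intro sum.cong) auto

lemma left_rate_sum:
  "(\<Sum>k\<in>{0} \<times> {1..m}. 1 / (case k of (i, j) \<Rightarrow> (if i = 0 then - z else a i) + (if j = 0 then z else b j)))
    = (\<Sum>j\<in>{1..m}. 1 / (b j - z))"
  by (simp add: sum.cartesian_product' cong: sum.cong_simp)

lemma bottom_sum_limit:
  assumes z: "\<bar>z\<bar> < c" and A: "(\<lambda>n. (\<Sum>i\<in>{1..n}. 1 / (a i + z)) / real n) \<longlonglongrightarrow> A" and x: "x > 0"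
  shows "AE \<omega> in M. (\<lambda>n. (\<Sum>i\<in>{1..nat \<lfloor>real (n\<^sup>2) * x\<rfloor>}. tilted z (i, 0) \<omega>) / real (n\<^sup>2)) \<longlonglongrightarrow> x * A"
proof -
  let ?p = "\<lambda>n. nat \<lfloor>real (n\<^sup>2) * x\<rfloor>"
  have "AE \<omega> in M. (\<lambda>n. (\<Sum>k\<in>{1..?p n} \<times> {0}. tilted z k \<omega>) / real (n\<^sup>2)) \<longlonglongrightarrow> x * A"
  proof (rule exponential_family_sum_limit)
    show "exponential_family (tilted z) (\<lambda>(i, j). (if i = 0 then - z else a i) + (if j = 0 then z else b j)) ({1..?p n} \<times> {0})" for n
      by (rule exponential_family_subset[OF tilted_family[OF z]]) auto
    show "(\<lambda>n. (\<Sum>k\<in>{1..?p n} \<times> {0}. 1 / (case k of (i, j) \<Rightarrow> (if i = 0 then - z else a i) + (if j = 0 then z else b j))) / real (n\<^sup>2)) \<longlonglongrightarrow> x * A"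
      using averages_along[OF A floor_ratio_limit[OF x] x]
      by (simp only: bottom_rate_sum)
    show "real (card ({1..?p n} \<times> {0::nat})) \<le> x * real n ^ 2" for n
      using of_nat_floor[of "real (n\<^sup>2) * x"] x by (simp add: mult.commute)
    show "0 < c - \<bar>z\<bar>" using z by simp
    show "c - \<bar>z\<bar> \<le> (case k of (i, j) \<Rightarrow> (if i = 0 then - z else a i) + (if j = 0 then z else b j))"
      if "k \<in> {1..?p n} \<times> {0}" for n k
      using a_ge[of "fst k"] that by (cases k) auto
  qed auto
  then show ?thesis by (simp add: sum.cartesian_product')
qed

lemma left_sum_limit:
  assumes z: "\<bar>z\<bar> < c" and B: "(\<lambda>n. (\<Sum>j\<in>{1..n}. 1 / (b j - z)) / real n) \<longlonglongrightarrow> B" and x: "x > 0"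
  shows "AE \<omega> in M. (\<lambda>n. (\<Sum>j\<in>{1..nat \<lfloor>real (n\<^sup>2) * x\<rfloor>}. tilted z (0, j) \<omega>) / real (n\<^sup>2)) \<longlonglongrightarrow> x * B"
proof -
  let ?p = "\<lambda>n. nat \<lfloor>real (n\<^sup>2) * x\<rfloor>"
  have "AE \<omega> in M. (\<lambda>n. (\<Sum>k\<in>{0} \<times> {1..?p n}. tilted z k \<omega>) / real (n\<^sup>2)) \<longlonglongrightarrow> x * B"
  proof (rule exponential_family_sum_limit)
    show "exponential_family (tilted z) (\<lambda>(i, j). (if i = 0 then - z else a i) + (if j = 0 then z else b j)) ({0} \<times> {1..?p n})" for n
      by (rule exponential_family_subset[OF tilted_family[OF z]]) auto
    show "(\<lambda>n. (\<Sum>k\<in>{0} \<times> {1..?p n}. 1 / (case k of (i, j) \<Rightarrow> (if i = 0 then - z else a i) + (if j = 0 then z else b j))) / real (n\<^sup>2)) \<longlonglongrightarrow> x * B"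
      using averages_along[OF B floor_ratio_limit[OF x] x]
      by (simp only: left_rate_sum)
    show "real (card ({0::nat} \<times> {1..?p n})) \<le> x * real n ^ 2" for n
      using of_nat_floor[of "real (n\<^sup>2) * x"] x by (simp add: mult.commute)
    show "0 < c - \<bar>z\<bar>" using z by simp
    show "c - \<bar>z\<bar> \<le> (case k of (i, j) \<Rightarrow> (if i = 0 then - z else a i) + (if j = 0 then z else b j))"
      if "k \<in> {0} \<times> {1..?p n}" for n k
      using b_ge[of "snd k"] that by (cases k) auto
  qed auto
  then show ?thesis by (simp add: sum.cartesian_product')
qed

text \<open>
  Both the left column and the increments along the top row are sums of
  independent exponential variables, and the averages of their means converge by assumption.
\<close>
lemma stationary_passage_limit:
  assumes z: "\<bar>z\<bar> < c" and A: "(\<lambda>n. (\<Sum>i\<in>{1..n}. 1 / (a i + z)) / real n) \<longlonglongrightarrow> A"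
    and B: "(\<lambda>n. (\<Sum>j\<in>{1..n}. 1 / (b j - z)) / real n) \<longlonglongrightarrow> B" and st: "s > 0" "t > 0"
  shows "AE \<omega> in M. (\<lambda>n. boundary_passage (\<lambda>k. tilted z k \<omega>) (nat \<lfloor>real (n\<^sup>2) * s\<rfloor>) (nat \<lfloor>real (n\<^sup>2) * t\<rfloor>) / real (n\<^sup>2))
     \<longlonglongrightarrow> s * A + t * B"
proof -
  let ?p = "\<lambda>n. nat \<lfloor>real (n\<^sup>2) * s\<rfloor>" and ?q = "\<lambda>n. nat \<lfloor>real (n\<^sup>2) * t\<rfloor>"
  let ?G = "\<lambda>i j \<omega>. boundary_passage (\<lambda>k. tilted z k \<omega>) i j"
  define D :: "nat \<Rightarrow> nat \<times> nat \<Rightarrow> 'a \<Rightarrow> real" where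
    "D n = (\<lambda>(i, j) \<omega>. ?G i (?q n) \<omega> - ?G (i - 1) (?q n) \<omega>)" for n
  have "AE \<omega> in M. (\<lambda>n. (\<Sum>k\<in>{1..?p n} \<times> {0}. D n k \<omega>) / real (n\<^sup>2)) \<longlonglongrightarrow> s * A"
  proof (rule exponential_family_sum_limit)
    show "exponential_family (D n) (\<lambda>(i, j). (if i = 0 then - z else a i) + (if j = 0 then z else b j)) ({1..?p n} \<times> {0})" for n
      unfolding D_def
      by (rule passage_increments_exponential[where \<alpha> = "\<lambda>i. if i = 0 then - z else a i" and \<beta> = "\<lambda>j. if j = 0 then z else b j"])
        (auto intro: exponential_family_subset[OF tilted_family[OF z]])
    show "(\<lambda>n. (\<Sum>k\<in>{1..?p n} \<times> {0}. 1 / (case k of (i, j) \<Rightarrow> (if i = 0 then - z else a i) + (if j = 0 then z else b j))) / real (n\<^sup>2)) \<longlonglongrightarrow> s * A"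
      using averages_along[OF A floor_ratio_limit[OF st(1)] st(1)]
      by (simp only: bottom_rate_sum)
    show "real (card ({1..?p n} \<times> {0::nat})) \<le> s * real n ^ 2" for n
      using of_nat_floor[of "real (n\<^sup>2) * s"] st by (simp add: mult.commute)
    show "0 < c - \<bar>z\<bar>" using z by simp
    show "c - \<bar>z\<bar> \<le> (case k of (i, j) \<Rightarrow> (if i = 0 then - z else a i) + (if j = 0 then z else b j))"
      if "k \<in> {1..?p n} \<times> {0}" for n k
      using a_ge[of "fst k"] that by (cases k) auto
  qed auto
  with left_sum_limit[OF z B st(2)] show ?thesis
  proof eventually_elim
    case (elim \<omega>)
    from tendsto_add[OF elim] show ?case
      by (subst passage_eq_left_plus_increments) (simp add: sum.cartesian_product' D_def add_divide_distrib add.commute)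
  qed
qed

text \<open>
  The tilted passage time dominates that of the model, since the boundary weights are nonnegative.
\<close>
theorem passage_constant_le:
  fixes \<gamma> :: ereal
  assumes shape: "AE \<omega> in M. (\<lambda>n. ereal (last_passage (\<lambda>k. X k \<omega>) (nat \<lfloor>real n * s\<rfloor>) (nat \<lfloor>real n * t\<rfloor>) / real n)) \<longlonglongrightarrow> \<gamma>"
    and st: "s > 0" "t > 0" and z: "\<bar>z\<bar> < c"
    and A: "(\<lambda>n. (\<Sum>i\<in>{1..n}. 1 / (a i + z)) / real n) \<longlonglongrightarrow> A"
    and B: "(\<lambda>n. (\<Sum>j\<in>{1..n}. 1 / (b j - z)) / real n) \<longlonglongrightarrow> B"
  shows "\<gamma> \<le> ereal (s * A + t * B)"
proof -
  have "AE \<omega> in M. \<gamma> \<le> ereal (s * A + t * B)"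
    using shape tilted_nonneg[OF z] stationary_passage_limit[OF z A B st]
  proof eventually_elim
    case (elim \<omega>)
    show ?case
    proof (rule LIMSEQ_le)
      show "(\<lambda>n. ereal (last_passage (\<lambda>k. X k \<omega>) (nat \<lfloor>real (n\<^sup>2) * s\<rfloor>) (nat \<lfloor>real (n\<^sup>2) * t\<rfloor>) / real (n\<^sup>2))) \<longlonglongrightarrow> \<gamma>"
        by (rule filterlim_compose[OF elim(1) filterlim_square_at_top])
      show "(\<lambda>n. ereal (boundary_passage (\<lambda>k. tilted z k \<omega>) (nat \<lfloor>real (n\<^sup>2) * s\<rfloor>) (nat \<lfloor>real (n\<^sup>2) * t\<rfloor>) / real (n\<^sup>2))) \<longlonglongrightarrow> ereal (s * A + t * B)"
        using elim(3) by (simp only: lim_ereal)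
      have "last_passage (\<lambda>k. X k \<omega>) i j \<le> boundary_passage (\<lambda>k. tilted z k \<omega>) i j" for i j
        by (rule last_passage_le_boundary_passage) (use elim(2) in \<open>auto simp: tilted_simps(3)\<close>)
      then show "\<exists>N. \<forall>n\<ge>N. ereal (last_passage (\<lambda>k. X k \<omega>) (nat \<lfloor>real (n\<^sup>2) * s\<rfloor>) (nat \<lfloor>real (n\<^sup>2) * t\<rfloor>) / real (n\<^sup>2))
         \<le> ereal (boundary_passage (\<lambda>k. tilted z k \<omega>) (nat \<lfloor>real (n\<^sup>2) * s\<rfloor>) (nat \<lfloor>real (n\<^sup>2) * t\<rfloor>) / real (n\<^sup>2))"
        by (auto intro!: divide_right_mono)
    qed
  qed
  then show ?thesis by simp
qed

text \<open>
  The pathwise bound \<open>boundary_passage_le_max\<close> with \<open>K\<close> of order \<open>\<epsilon> * n\<close>, applied to the tilts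
  \<open>w < z < w'\<close>: lowering the tilt increases the weights on the bottom axis, raising it
  increases those on the left axis.
\<close>
theorem stationary_constant_le_max:
  fixes \<gamma> :: real
  assumes shape: "AE \<omega> in M. (\<lambda>n. ereal (last_passage (\<lambda>k. X k \<omega>) (nat \<lfloor>real n * s\<rfloor>) (nat \<lfloor>real n * t\<rfloor>) / real n)) \<longlonglongrightarrow> ereal \<gamma>"
    and st: "s > 0" "t > 0" and \<epsilon>: "\<epsilon> > 0" and z: "\<bar>w\<bar> < c" "\<bar>z\<bar> < c" "\<bar>w'\<bar> < c" "w < z" "z < w'"
    and A: "\<And>u. u \<in> {w, z, w'} \<Longrightarrow> (\<lambda>n. (\<Sum>i\<in>{1..n}. 1 / (a i + u)) / real n) \<longlonglongrightarrow> A u"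
    and B: "\<And>u. u \<in> {w, z, w'} \<Longrightarrow> (\<lambda>n. (\<Sum>j\<in>{1..n}. 1 / (b j - u)) / real n) \<longlonglongrightarrow> B u"
  shows "s * A z + t * B z \<le> max (\<epsilon> * A z + \<epsilon> * B z + \<gamma>)
    (max (\<epsilon> * A z - \<epsilon> * A w + (s * A w + t * B w)) (\<epsilon> * B z - \<epsilon> * B w' + (s * A w' + t * B w')))"
proof -
  have A': "(\<lambda>n. (\<Sum>i\<in>{1..n}. 1 / (a i + w)) / real n) \<longlonglongrightarrow> A w"
    "(\<lambda>n. (\<Sum>i\<in>{1..n}. 1 / (a i + z)) / real n) \<longlonglongrightarrow> A z"
    "(\<lambda>n. (\<Sum>i\<in>{1..n}. 1 / (a i + w')) / real n) \<longlonglongrightarrow> A w'"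
    by (rule A; simp)+
  have B': "(\<lambda>n. (\<Sum>j\<in>{1..n}. 1 / (b j - w)) / real n) \<longlonglongrightarrow> B w"
    "(\<lambda>n. (\<Sum>j\<in>{1..n}. 1 / (b j - z)) / real n) \<longlonglongrightarrow> B z"
    "(\<lambda>n. (\<Sum>j\<in>{1..n}. 1 / (b j - w')) / real n) \<longlonglongrightarrow> B w'"
    by (rule B; simp)+
  have "AE \<omega> in M. ?thesis"
    using shape tilted_nonneg[OF z(2)] stationary_passage_limit[OF z(2) A'(2) B'(2) st]
      stationary_passage_limit[OF z(1) A'(1) B'(1) st] stationary_passage_limit[OF z(3) A'(3) B'(3) st]
      bottom_sum_limit[OF z(2) A'(2) \<epsilon>] bottom_sum_limit[OF z(1) A'(1) \<epsilon>]
      left_sum_limit[OF z(2) B'(2) \<epsilon>] left_sum_limit[OF z(3) B'(3) \<epsilon>]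
  proof eventually_elim
    case (elim \<omega>)
    let ?f = "\<lambda>x n. nat \<lfloor>real (n\<^sup>2) * x\<rfloor>"
    let ?N = "\<lambda>n. real (n\<^sup>2)"
    let ?G = "\<lambda>u. boundary_passage (\<lambda>k. tilted u k \<omega>)"
    let ?L = "last_passage (\<lambda>k. X k \<omega>)"
    have "(\<lambda>n. ereal (?L (?f s n) (?f t n) / ?N n)) \<longlonglongrightarrow> \<gamma>"
      by (rule filterlim_compose[OF elim(1) filterlim_square_at_top])
    then have L: "(\<lambda>n. ?L (?f s n) (?f t n) / ?N n) \<longlonglongrightarrow> \<gamma>" by (simp only: lim_ereal)
    have bound: "?G z i j \<le> max (?G z K 0 + ?G z 0 K + ?L i j)
       (max (?G z K 0 - ?G w K 0 + ?G w i j) (?G z 0 K - ?G w' 0 K + ?G w' i j))" for i j K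
    proof (rule boundary_passage_le_max)
      fix i j :: nat assume "i \<ge> 1" "j \<ge> 1"
      then show "tilted z (i, j) \<omega> = X (i, j) \<omega> \<and> tilted w (i, j) \<omega> = X (i, j) \<omega> \<and> tilted w' (i, j) \<omega> = X (i, j) \<omega>"
        by (simp add: tilted_simps)
    next
      fix i :: nat assume i: "i \<ge> 1"
      have d: "0 < a i + w" "0 < a i + z" "a i + w \<le> a i + z" using a_ge[OF i] z by auto
      have nn: "0 \<le> tilted z (i, 0) \<omega>" using elim(2) i by auto
      then have "0 \<le> X (i, 0) \<omega>" using d i by (simp add: tilted_simps zero_le_divide_iff)
      then have "tilted z (i, 0) \<omega> \<le> tilted w (i, 0) \<omega>"
        using d i by (auto simp: tilted_simps intro!: divide_left_mono)
      with nn show "0 \<le> tilted z (i, 0) \<omega> \<and> tilted z (i, 0) \<omega> \<le> tilted w (i, 0) \<omega>" by simp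
    next
      fix j :: nat assume j: "j \<ge> 1"
      have d: "0 < b j - w'" "0 < b j - z" "b j - w' \<le> b j - z" using b_ge[OF j] z by auto
      have nn: "0 \<le> tilted z (0, j) \<omega>" using elim(2) j by auto
      then have "0 \<le> X (0, j) \<omega>" using d j by (simp add: tilted_simps zero_le_divide_iff)
      then have "tilted z (0, j) \<omega> \<le> tilted w' (0, j) \<omega>"
        using d j by (auto simp: tilted_simps intro!: divide_left_mono)
      with nn show "0 \<le> tilted z (0, j) \<omega> \<and> tilted z (0, j) \<omega> \<le> tilted w' (0, j) \<omega>" by simp
    qed
    have scaled: "x / N \<le> max ((h + v + l) / N) (max ((h - h' + g) / N) ((v - v' + g') / N))"
      if "x \<le> max (h + v + l) (max (h - h' + g) (v - v' + g'))" "0 \<le> N" for x h v l h' g v' g' N :: real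
      using that by (auto simp: le_max_iff_disj intro: divide_right_mono)
    show ?case
    proof (rule LIMSEQ_le[OF elim(3)])
      show "(\<lambda>n. max ((?G z (?f \<epsilon> n) 0 + ?G z 0 (?f \<epsilon> n) + ?L (?f s n) (?f t n)) / ?N n)
         (max ((?G z (?f \<epsilon> n) 0 - ?G w (?f \<epsilon> n) 0 + ?G w (?f s n) (?f t n)) / ?N n)
              ((?G z 0 (?f \<epsilon> n) - ?G w' 0 (?f \<epsilon> n) + ?G w' (?f s n) (?f t n)) / ?N n)))
        \<longlonglongrightarrow> max (\<epsilon> * A z + \<epsilon> * B z + \<gamma>)
            (max (\<epsilon> * A z - \<epsilon> * A w + (s * A w + t * B w)) (\<epsilon> * B z - \<epsilon> * B w' + (s * A w' + t * B w')))"
        unfolding boundary_passage_bottom boundary_passage_left add_divide_distrib diff_divide_distrib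
        by (intro tendsto_max tendsto_add tendsto_diff elim L)
      show "\<exists>N. \<forall>n\<ge>N. ?G z (?f s n) (?f t n) / ?N n \<le> max ((?G z (?f \<epsilon> n) 0 + ?G z 0 (?f \<epsilon> n) + ?L (?f s n) (?f t n)) / ?N n)
         (max ((?G z (?f \<epsilon> n) 0 - ?G w (?f \<epsilon> n) 0 + ?G w (?f s n) (?f t n)) / ?N n)
              ((?G z 0 (?f \<epsilon> n) - ?G w' 0 (?f \<epsilon> n) + ?G w' (?f s n) (?f t n)) / ?N n))"
        by (intro exI allI impI scaled bound) simp
    qed
  qed
  then show ?thesis by simp
qed

end

section \<open>Ergodic theorem\<close>

lemma funpow_measurable: "T \<in> measurable M M \<Longrightarrow> (T ^^ k) \<in> measurable M M"
  by (induction k) (auto intro: measurable_comp simp: id_def)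

text \<open>
  The set \<open>B\<close> where the partial sums are unbounded above is invariant, so it has probability \<open>0\<close> or
  \<open>1\<close>. Let \<open>U n\<close> be the maximum of \<open>0\<close> and the first \<open>n\<close> partial sums. Then
  \<open>U (Suc n) - U n \<circ> T = max (- U n \<circ> T) f\<close>, which has nonnegative expectation because
  \<open>T\<close> preserves the measure and \<open>U\<close> increases with \<open>n\<close>. On \<open>B\<close> it converges to \<open>f\<close>, so if \<open>B\<close> had
  probability \<open>1\<close>, dominated convergence would make the expectation of \<open>f\<close> nonnegative.
\<close>
lemma ergodic_sums_bounded_above:
  fixes f :: "'a \<Rightarrow> real"
  assumes "prob_space M" and erg: "ergodic_map M T" and int: "integrable M f" and neg: "(\<integral>x. f x \<partial>M) < 0"
  shows "AE x in M. bdd_above (range (\<lambda>n. \<Sum>k<n. f ((T ^^ k) x)))"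
proof -
  interpret prob_space M by fact
  have T[measurable]: "T \<in> measurable M M" and preserve: "distr M M T = M"
    and zero_one: "\<And>A. A \<in> sets M \<Longrightarrow> T -` A \<inter> space M = A \<Longrightarrow> measure M A = 0 \<or> measure M A = 1"
    using erg by (auto simp: ergodic_map_def measure_preserving_map_def)
  have f[measurable]: "f \<in> borel_measurable M" using int by auto
  have fT[measurable]: "(\<lambda>x. f ((T ^^ k) x)) \<in> borel_measurable M" for k
    using measurable_compose[OF funpow_measurable[OF T] f] .
  have intT: "integrable M (\<lambda>x. h (T x))" "(\<integral>x. h (T x) \<partial>M) = (\<integral>x. h x \<partial>M)" if "integrable M h" for h :: "'a \<Rightarrow> real"
    using that integrable_distr_eq[OF T, of h] integral_distr[OF T, of h] by (auto simp: preserve)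
  define S where "S n x = (\<Sum>k<n. f ((T ^^ k) x))" for n x
  have S_Suc: "S (Suc n) x = f x + S n (T x)" for n x
    unfolding S_def by (subst sum.lessThan_Suc_shift) (simp add: funpow_swap1)
  have [measurable]: "S n \<in> borel_measurable M" for n unfolding S_def by measurable
  define U where "U n x = rec_nat (\<lambda>_. 0) (\<lambda>_ u x. max 0 (f x + u (T x))) n x" for n x
  have U_simps: "U 0 x = 0" "U (Suc n) x = max 0 (f x + U n (T x))" for n x
    by (simp_all add: U_def)
  have U_nonneg: "0 \<le> U n x" for n x by (cases n) (auto simp: U_simps)
  have U_mono: "U n x \<le> U (Suc n) x" for n x
  proof (induction n arbitrary: x)
    case 0 then show ?case using U_nonneg by (simp add: U_simps(1))
  next
    case (Suc n)
    show ?case unfolding U_simps(2)[of n x] U_simps(2)[of "Suc n" x] using Suc.IH[of "T x"] by simp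
  qed
  have S_le_U: "S n x \<le> U n x" for n x
  proof (induction n arbitrary: x)
    case 0 then show ?case by (simp add: S_def U_simps)
  next
    case (Suc n)
    show ?case unfolding S_Suc U_simps(2) using Suc.IH[of "T x"] by simp
  qed
  have U_int: "integrable M (U n)" for n
  proof (induction n)
    case 0 then show ?case by (simp add: U_simps(1)[abs_def])
  next
    case (Suc n)
    then show ?case using intT(1)[OF Suc] int by (simp add: U_simps(2)[abs_def])
  qed
  define B where "B = {x \<in> space M. \<not> bdd_above (range (\<lambda>n. S n x))}"
  have B_alt: "B = {x \<in> space M. \<forall>m::nat. \<exists>n. real m < S n x}"
  proof -
    have "(\<not> bdd_above (range (\<lambda>n. S n x))) \<longleftrightarrow> (\<forall>m::nat. \<exists>n. real m < S n x)" for x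
      unfolding bdd_above_def by (auto simp: not_le) (meson le_less_trans real_arch_simple)
    then show ?thesis by (simp add: B_def)
  qed
  have B_sets[measurable]: "B \<in> sets M" unfolding B_alt by measurable
  have "bdd_above (range (\<lambda>n. S n (T x))) \<longleftrightarrow> bdd_above (range (\<lambda>n. S n x))" for x
  proof
    assume "bdd_above (range (\<lambda>n. S n (T x)))"
    then obtain c where c: "\<And>n. S n (T x) \<le> c" by (auto simp: bdd_above_def)
    have "S n x \<le> max 0 (f x + c)" for n
      using c by (cases n) (auto simp: S_Suc S_def[of 0] le_max_iff_disj)
    then show "bdd_above (range (\<lambda>n. S n x))" by (auto simp: bdd_above_def)
  next
    assume "bdd_above (range (\<lambda>n. S n x))"
    then obtain c where c: "\<And>n. S n x \<le> c" by (auto simp: bdd_above_def)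
    have "S n (T x) \<le> c - f x" for n
      using c[of "Suc n"] by (simp add: S_Suc)
    then show "bdd_above (range (\<lambda>n. S n (T x)))" by (auto simp: bdd_above_def)
  qed
  then have "T -` B \<inter> space M = B"
    using measurable_space[OF T] by (auto simp: B_def)
  from zero_one[OF B_sets this] have "prob B = 0"
  proof
    assume "prob B = 1"
    then have AE_B: "AE x in M. x \<in> B" using B_sets by (simp add: prob_eq_1)
    have lim: "AE x in M. (\<lambda>n. U (Suc n) x - U n (T x)) \<longlonglongrightarrow> f x"
      using AE_B
    proof eventually_elim
      case (elim x)
      then have "T x \<in> B" using \<open>T -` B \<inter> space M = B\<close> by auto
      then obtain n where n: "\<bar>f x\<bar> < S n (T x)"
        unfolding B_alt by (auto) (meson le_less_trans real_arch_simple)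
      have "U (Suc k) x - U k (T x) = f x" if "k \<ge> n" for k
      proof -
        have "U n (T x) \<le> U k (T x)" using lift_Suc_mono_le[of "\<lambda>k. U k (T x)", OF U_mono that] .
        then have "\<bar>f x\<bar> < U k (T x)" using n S_le_U[of n "T x"] by simp
        then show ?thesis by (auto simp: U_simps(2))
      qed
      then show ?case by (intro tendsto_eventually) (auto simp: eventually_at_top_linorder)
    qed
    have "(\<lambda>n. \<integral>x. (U (Suc n) x - U n (T x)) \<partial>M) \<longlonglongrightarrow> (\<integral>x. f x \<partial>M)"
    proof (rule integral_dominated_convergence[OF _ _ _ lim])
      show "integrable M (\<lambda>x. \<bar>f x\<bar>)" using int by simp
      show "AE x in M. norm (U (Suc n) x - U n (T x)) \<le> \<bar>f x\<bar>" for n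
        using U_nonneg[of n] by (auto simp: U_simps(2) max_def)
      show "(\<lambda>x. U (Suc n) x - U n (T x)) \<in> borel_measurable M" for n
        using U_int intT(1)[OF U_int] by (intro borel_measurable_diff borel_measurable_integrable)
    qed (use f in auto)
    moreover have "0 \<le> (\<integral>x. (U (Suc n) x - U n (T x)) \<partial>M)" for n
      using U_int intT[OF U_int[of n]] integral_mono[OF U_int U_int U_mono, of n] by simp
    ultimately have "0 \<le> (\<integral>x. f x \<partial>M)" by (intro LIMSEQ_le_const) auto
    then show ?thesis using neg by simp
  qed
  then have "AE x in M. x \<notin> B" using B_sets by (simp add: prob_eq_0)
  with AE_space show ?thesis
    by eventually_elim (auto simp: B_def S_def)
qed

text \<open>
  Birkhoff's theorem for an ergodic map. The preceding lemma applies to \<open>f\<close> and to \<open>- f\<close>, each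
  lowered by slightly more than its expectation.
\<close>
theorem ergodic_averages_converge:
  fixes f :: "'a \<Rightarrow> real"
  assumes M: "prob_space M" and erg: "ergodic_map M T" and int: "integrable M f"
  shows "AE x in M. (\<lambda>n. (\<Sum>k<n. f ((T ^^ k) x)) / real n) \<longlonglongrightarrow> (\<integral>x. f x \<partial>M)"
proof -
  interpret prob_space M by fact
  define e where "e = (\<integral>x. f x \<partial>M)"
  have upper: "AE x in M. \<forall>m. \<exists>c. \<forall>n. (\<Sum>k<n. h ((T ^^ k) x)) \<le> real n * ((\<integral>x. h x \<partial>M) + inverse (real (Suc m))) + c"
    if h: "integrable M h" for h :: "'a \<Rightarrow> real"
  proof (subst AE_all_countable, intro allI)
    fix m
    let ?d = "(\<integral>x. h x \<partial>M) + inverse (real (Suc m))"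
    have "AE x in M. bdd_above (range (\<lambda>n. \<Sum>k<n. (\<lambda>x. h x - ?d) ((T ^^ k) x)))"
      by (rule ergodic_sums_bounded_above[OF M erg]) (use h in \<open>simp_all add: prob_space\<close>)
    then show "AE x in M. \<exists>c. \<forall>n. (\<Sum>k<n. h ((T ^^ k) x)) \<le> real n * ?d + c"
    proof eventually_elim
      case (elim x)
      then obtain c where c: "\<And>n. (\<Sum>k<n. h ((T ^^ k) x) - ?d) \<le> c" by (auto simp: bdd_above_def)
      have "(\<Sum>k<n. h ((T ^^ k) x)) \<le> real n * ?d + c" for n
        using c[of n] by (simp add: sum_subtractf)
      then show ?case by blast
    qed
  qed
  have ev: "eventually (\<lambda>n. s n / real n < d + \<epsilon>) sequentially"
    if s: "\<forall>m. \<exists>c. \<forall>n. s n \<le> real n * (d + inverse (real (Suc m))) + c" and eps: "\<epsilon> > 0" for s :: "nat \<Rightarrow> real" and d \<epsilon> :: real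
  proof -
    obtain m where m: "inverse (real (Suc m)) < \<epsilon> / 2" using reals_Archimedean[of "\<epsilon> / 2"] eps by auto
    obtain c where c: "\<And>n. s n \<le> real n * (d + inverse (real (Suc m))) + c" using s by blast
    have "(\<lambda>n. c / real n) \<longlonglongrightarrow> 0" by (rule lim_const_over_n)
    then have "eventually (\<lambda>n. c / real n < \<epsilon> / 2) sequentially" using eps by (intro order_tendstoD) auto
    with eventually_gt_at_top[of 0] show ?thesis
    proof eventually_elim
      case (elim n)
      have "s n / real n \<le> (d + inverse (real (Suc m))) + c / real n"
        using divide_right_mono[OF c[of n], of "real n"] elim by (simp add: add_divide_distrib)
      then show ?case using m elim by linarith
    qed
  qed
  have "integrable M (\<lambda>x. - f x)" using int by simp
  from upper[OF int] upper[OF this] show ?thesis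
  proof eventually_elim
    case (elim x)
    let ?s = "\<lambda>n. \<Sum>k<n. f ((T ^^ k) x)"
    show ?case
    proof (rule tendstoI)
      fix \<epsilon> :: real assume eps: "\<epsilon> > 0"
      have "eventually (\<lambda>n. ?s n / real n < e + \<epsilon>) sequentially"
        by (rule ev) (use elim eps in \<open>auto simp: e_def\<close>)
      moreover have "eventually (\<lambda>n. (- ?s n) / real n < - e + \<epsilon>) sequentially"
        by (rule ev) (use elim eps in \<open>auto simp: e_def sum_negf\<close>)
      ultimately show "eventually (\<lambda>n. dist (?s n / real n) (\<integral>x. f x \<partial>M) < \<epsilon>) sequentially"
        by eventually_elim (auto simp: dist_real_def e_def[symmetric] abs_less_iff)
    qed
  qed
qed

section \<open>From the averaged law to fixed environments\<close>

abbreviation grid :: "(nat \<times> nat) set" where "grid \<equiv> {1..} \<times> {1..}"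

lemma cond_weight_law_eq: "cond_weight_law e = PiM grid (\<lambda>(i, j). exp_law (fst e i + snd e j))"
  by (cases e) (simp add: cond_weight_law_def)

lemma env_space_positive:
  assumes "e \<in> space env_space" "i \<ge> 1" shows "0 < fst e i" "0 < snd e i"
  using assms by (auto simp: env_space_def pos_seq_space_def space_pair_measure space_PiM PiE_iff space_restrict_space)

lemma env_components_measurable:
  assumes "i \<ge> 1"
  shows "(\<lambda>e. fst e i) \<in> borel_measurable env_space" "(\<lambda>e. snd e i) \<in> borel_measurable env_space"
proof -
  have "(\<lambda>c. c i) \<in> measurable pos_seq_space (restrict_space borel {0<..})"
    unfolding pos_seq_space_def using assms by (intro measurable_component_singleton) auto
  then have c: "(\<lambda>c. c i) \<in> borel_measurable pos_seq_space"
    by (simp add: measurable_restrict_space2_iff)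
  show "(\<lambda>e. fst e i) \<in> borel_measurable env_space" "(\<lambda>e. snd e i) \<in> borel_measurable env_space"
    unfolding env_space_def by (rule measurable_compose[OF measurable_fst c] measurable_compose[OF measurable_snd c])+
qed

lemma exp_law_emeasure_measurable:
  assumes r[measurable]: "r \<in> borel_measurable M" and A[measurable]: "A \<in> sets borel"
  shows "(\<lambda>x. emeasure (exp_law (r x)) A) \<in> borel_measurable M"
proof -
  have "emeasure (exp_law (r x)) A = (\<integral>\<^sup>+y. ennreal (if y < 0 then 0 else r x * exp (- y * r x)) * indicator A y \<partial>lborel)" for x
    using A by (simp add: emeasure_density exponential_density_def)
  then show ?thesis by simp
qed

text \<open>
  Cylinder sets are stable under intersection and generate the product space, and the
  probability of a cylinder set is a finite product of exponential probabilities that depend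
  measurably on finitely many rates.
\<close>
lemma cond_weight_law_kernel: "cond_weight_law \<in> measurable env_space (prob_algebra (PiM grid (\<lambda>_. borel)))"
proof (rule measurable_prob_algebra_generated[OF sets_PiM Int_stable_prod_algebra prod_algebra_sets_into_space])
  fix e assume e: "e \<in> space env_space"
  then have pos: "0 < fst e i + snd e j" if "(i, j) \<in> grid" for i j
    using env_space_positive[OF e, of i] env_space_positive[OF e, of j] that by auto
  show "prob_space (cond_weight_law e)"
    unfolding cond_weight_law_eq using pos
    by (intro prob_space_PiM) (auto intro!: prob_space_exponential_density)
  show "sets (cond_weight_law e) = sets (PiM grid (\<lambda>_. borel))"
    unfolding cond_weight_law_eq by (intro sets_PiM_cong) auto
next
  fix A :: "(nat \<times> nat \<Rightarrow> real) set" assume "A \<in> prod_algebra grid (\<lambda>_. borel)"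
  then obtain J F where A: "A = prod_emb grid (\<lambda>_. borel) J (Pi\<^sub>E J F)" and J: "finite J" "J \<subseteq> grid"
    and F: "\<And>i. i \<in> J \<Longrightarrow> F i \<in> sets borel"
    by (auto elim!: prod_algebraE)
  have "emeasure (cond_weight_law e) A = (\<Prod>k\<in>J. emeasure (exp_law (fst e (fst k) + snd e (snd k))) (F k))"
    if e: "e \<in> space env_space" for e
  proof -
    have "0 < fst e i + snd e j" if "(i, j) \<in> grid" for i j
      using env_space_positive[OF e, of i] env_space_positive[OF e, of j] that by auto
    then have "emeasure (PiM grid (\<lambda>(i, j). exp_law (fst e i + snd e j))) (prod_emb grid (\<lambda>(i, j). exp_law (fst e i + snd e j)) J (Pi\<^sub>E J F))
      = (\<Prod>k\<in>J. emeasure (case k of (i, j) \<Rightarrow> exp_law (fst e i + snd e j)) (F k))"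
      using J F by (intro emeasure_PiM_emb) (auto intro!: prob_space_exponential_density)
    moreover have "prod_emb grid (\<lambda>(i, j). exp_law (fst e i + snd e j)) J (Pi\<^sub>E J F) = A"
      unfolding A by (auto simp: prod_emb_def)
    ultimately show ?thesis by (simp add: cond_weight_law_eq case_prod_unfold)
  qed
  moreover have "(\<lambda>e. \<Prod>k\<in>J. emeasure (exp_law (fst e (fst k) + snd e (snd k))) (F k)) \<in> borel_measurable env_space"
    using J F by (intro borel_measurable_prod_ennreal exp_law_emeasure_measurable borel_measurable_add env_components_measurable) auto
  ultimately show "(\<lambda>e. emeasure (cond_weight_law e) A) \<in> borel_measurable env_space"
    by (simp cong: measurable_cong)
qed

text \<open>
  The property \<open>P\<close> itself may fail to be measurable, so the statement is passed
  through a measurable null set that contains its exceptional set.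
\<close>
lemma AE_cond_weight_law:
  assumes prob: "prob_space \<mu>" and sets: "sets \<mu> = sets env_space" and P: "AE W in weight_law \<mu>. P W"
  shows "AE e in \<mu>. AE W in cond_weight_law e. P W"
proof -
  have K: "cond_weight_law \<in> measurable \<mu> (subprob_algebra (PiM grid (\<lambda>_. borel)))"
    using measurable_prob_algebraD[OF cond_weight_law_kernel] by (simp cong: measurable_cong_sets add: sets)
  obtain N where N: "N \<in> null_sets (weight_law \<mu>)" "{W \<in> space (weight_law \<mu>). \<not> P W} \<subseteq> N"
    using P by (auto simp: eventually_ae_filter)
  have sw: "sets (weight_law \<mu>) = sets (PiM grid (\<lambda>_. borel :: real measure))"
    unfolding weight_law_def by (rule sets_bind[OF sets_kernel[OF K] prob_space.not_empty[OF prob]])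
  have "N \<in> sets (weight_law \<mu>)" using N(1) by auto
  then have [measurable]: "N \<in> sets (PiM grid (\<lambda>_. borel))" unfolding sw .
  have "AE W in weight_law \<mu>. W \<notin> N" using N by (auto intro: AE_not_in)
  moreover have "Measurable.pred (PiM grid (\<lambda>_. borel)) (\<lambda>W. W \<notin> N)" by measurable
  ultimately have "AE e in \<mu>. AE W in cond_weight_law e. W \<notin> N"
    unfolding weight_law_def using AE_bind[OF K, of "\<lambda>W. W \<notin> N"] by blast
  with AE_space show ?thesis
  proof eventually_elim
    case (elim e)
    have "space (cond_weight_law e) = space (weight_law \<mu>)"
      using sets_eq_imp_space_eq[OF sets_kernel[OF K elim(1)]] sets_eq_imp_space_eq[OF sw] by simp
    then show ?case
      using N by (intro eventually_elim2[OF elim(2) AE_space]) auto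
  qed
qed

lemma last_passage_restrict: "last_passage (restrict W grid) i j = last_passage W i j"
  by (induction W i j rule: last_passage.induct) auto

text \<open>
  The boundary weights need randomness beyond the weights of the model; it is placed on the axes of the
  same array.
\<close>
definition extended_law :: "(nat \<Rightarrow> real) \<times> (nat \<Rightarrow> real) \<Rightarrow> (nat \<times> nat \<Rightarrow> real) measure" where
  "extended_law e = PiM UNIV (\<lambda>(i, j). exp_law (if i = 0 \<or> j = 0 then 1 else fst e i + snd e j))"

context
  fixes e :: "(nat \<Rightarrow> real) \<times> (nat \<Rightarrow> real)" and c :: real
  assumes c: "c > 0" and ge: "\<And>i. i \<ge> 1 \<Longrightarrow> c \<le> fst e i" "\<And>i. i \<ge> 1 \<Longrightarrow> c \<le> snd e i"
begin

lemma extended_law_components: "prob_space (case k of (i, j) \<Rightarrow> exp_law (if i = 0 \<or> j = 0 then 1 else fst e i + snd e j))"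
proof -
  have "0 < fst e i + snd e j" if "i \<noteq> 0" "j \<noteq> 0" for i j
    using ge(1)[of i] ge(2)[of j] c that by auto
  then show ?thesis by (cases k) (auto intro!: prob_space_exponential_density)
qed

lemma extended_law_passage: "exponential_passage (extended_law e) (\<lambda>k \<omega>. \<omega> k) (fst e) (snd e) c"
proof -
  let ?E = "\<lambda>(i, j). exp_law (if i = 0 \<or> j = 0 then 1 else fst e i + snd e j)"
  interpret P: prob_space "extended_law e"
    unfolding extended_law_def by (rule prob_space_PiM) (rule extended_law_components)
  have meas: "(\<lambda>\<omega>. \<omega> k) \<in> borel_measurable (extended_law e)" for k
  proof -
    have "(\<lambda>\<omega>. \<omega> k) \<in> measurable (extended_law e) (?E k)"
      unfolding extended_law_def by (rule measurable_component_singleton) simp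
    then show ?thesis by (cases k) simp
  qed
  have law: "distr (extended_law e) borel (\<lambda>\<omega>. \<omega> k) = ?E k" for k
  proof -
    have "distr (extended_law e) (?E k) (\<lambda>\<omega>. \<omega> k) = ?E k"
      unfolding extended_law_def by (rule distr_PiM_component[OF extended_law_components UNIV_I])
    moreover have "distr (extended_law e) (?E k) (\<lambda>\<omega>. \<omega> k) = distr (extended_law e) borel (\<lambda>\<omega>. \<omega> k)"
      by (intro distr_cong) (auto split: prod.split)
    ultimately show ?thesis by simp
  qed
  have "P.indep_vars (\<lambda>_. borel) (\<lambda>k \<omega>. \<omega> k) UNIV"
  proof (subst P.indep_vars_iff_distr_eq_PiM)
    have "distr (extended_law e) (PiM UNIV (\<lambda>_. borel)) (\<lambda>\<omega>. \<lambda>k\<in>UNIV. \<omega> k) = distr (extended_law e) (extended_law e) (\<lambda>\<omega>. \<omega>)"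
      unfolding extended_law_def by (intro distr_cong sets_PiM_cong) (auto split: prod.split)
    then show "distr (extended_law e) (PiM UNIV (\<lambda>_. borel)) (\<lambda>\<omega>. \<lambda>k\<in>UNIV. \<omega> k) = PiM UNIV (\<lambda>k. distr (extended_law e) borel (\<lambda>\<omega>. \<omega> k))"
      unfolding law by (simp add: distr_id extended_law_def)
  qed (use meas in auto)
  moreover have "0 < fst e i + snd e j" if "i \<noteq> 0" "j \<noteq> 0" for i j
    using ge(1)[of i] ge(2)[of j] c that by auto
  ultimately have "P.exponential_family (\<lambda>k \<omega>. \<omega> k) (\<lambda>(i, j). if i = 0 \<or> j = 0 then 1 else fst e i + snd e j) UNIV"
    unfolding P.exponential_family_def by (auto simp: law)
  then show ?thesis using ge by unfold_locales auto
qed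

text \<open>
  Restricting the enlarged array to the interior recovers the conditional law of the weights.
\<close>
lemma AE_extended_law:
  assumes "AE W in cond_weight_law e. P W"
  shows "AE W in extended_law e. P (restrict W grid)"
proof -
  let ?E = "\<lambda>(i, j). exp_law (if i = 0 \<or> j = 0 then 1 else fst e i + snd e j)"
  have "cond_weight_law e = PiM grid ?E"
    unfolding cond_weight_law_eq by (intro PiM_cong) auto
  also have "\<dots> = distr (extended_law e) (PiM grid ?E) (\<lambda>\<omega>. restrict \<omega> grid)"
    using distr_PiM_reindex[of UNIV ?E "\<lambda>k. k" grid] extended_law_components
    by (simp add: extended_law_def restrict_def[symmetric] del: split_paired_All)
  finally have eq: "cond_weight_law e = distr (extended_law e) (PiM grid ?E) (\<lambda>\<omega>. restrict \<omega> grid)" .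
  have "(\<lambda>\<omega>. restrict \<omega> grid) \<in> measurable (extended_law e) (PiM grid ?E)"
    unfolding extended_law_def by (rule measurable_restrict_subset) simp
  from AE_distrD[OF this] assms show ?thesis unfolding eq by simp
qed

end

section \<open>Averages over an ergodic environment\<close>

lemma shift2_funpow:
  assumes "i \<ge> 1"
  shows "fst ((shift2 1 1 ^^ k) e) i = fst e (i + k)" "snd ((shift2 1 1 ^^ k) e) i = snd e (i + k)"
  using assms
  by (induction k arbitrary: i) (auto simp: shift2_def shift_seq_def case_prod_beta)

context
  fixes \<mu> :: "((nat \<Rightarrow> real) \<times> (nat \<Rightarrow> real)) measure"
  assumes env: "ergodic_environment \<mu>"
begin

lemma environment_prob_space: "prob_space \<mu>" and environment_sets: "sets \<mu> = sets env_space"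
  and environment_shift_ergodic: "ergodic_map \<mu> (shift2 1 1)"
  using env by (auto simp: ergodic_environment_def)

lemma environment_component_measurable:
  assumes "i \<ge> 1"
  shows "(\<lambda>e. fst e i) \<in> borel_measurable \<mu>" "(\<lambda>e. snd e i) \<in> borel_measurable \<mu>"
  using env_components_measurable[OF assms] by (simp_all cong: measurable_cong_sets add: environment_sets)

lemma environment_averages:
  fixes f :: "real \<Rightarrow> real"
  shows "integrable \<mu> (\<lambda>e. f (fst e 1)) \<Longrightarrow>
      AE e in \<mu>. (\<lambda>n. (\<Sum>i\<in>{1..n}. f (fst e i)) / real n) \<longlonglongrightarrow> (\<integral>e. f (fst e 1) \<partial>\<mu>)"
    and "integrable \<mu> (\<lambda>e. f (snd e 1)) \<Longrightarrow>
      AE e in \<mu>. (\<lambda>n. (\<Sum>i\<in>{1..n}. f (snd e i)) / real n) \<longlonglongrightarrow> (\<integral>e. f (snd e 1) \<partial>\<mu>)"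
  using ergodic_averages_converge[OF environment_prob_space environment_shift_ergodic, of "\<lambda>e. f (fst e 1)"]
    ergodic_averages_converge[OF environment_prob_space environment_shift_ergodic, of "\<lambda>e. f (snd e 1)"]
  by (simp_all add: shift2_funpow[of 1, simplified] sum.atLeast1_atMost_eq)

lemma environment_AE_shift:
  assumes "AE e in \<mu>. P e" shows "AE e in \<mu>. P ((shift2 1 1 ^^ k) e)"
proof (induction k)
  case (Suc k)
  have T: "shift2 1 1 \<in> measurable \<mu> \<mu>" "distr \<mu> \<mu> (shift2 1 1) = \<mu>"
    using environment_shift_ergodic by (auto simp: ergodic_map_def measure_preserving_map_def)
  have "AE e in distr \<mu> \<mu> (shift2 1 1). P ((shift2 1 1 ^^ k) e)" unfolding T(2) by (rule Suc)
  from AE_distrD[OF T(1) this] show ?case by (simp add: funpow_swap1)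
qed (simp add: assms)

lemma environment_AE_all:
  shows "AE e in \<mu>. P (fst e 1) \<Longrightarrow> AE e in \<mu>. \<forall>i\<ge>1. P (fst e i)"
    and "AE e in \<mu>. P (snd e 1) \<Longrightarrow> AE e in \<mu>. \<forall>i\<ge>1. P (snd e i)"
proof -
  assume "AE e in \<mu>. P (fst e 1)"
  from environment_AE_shift[OF this] have "AE e in \<mu>. \<forall>k. P (fst e (1 + k))"
    by (simp add: AE_all_countable shift2_funpow[of 1, simplified])
  then show "AE e in \<mu>. \<forall>i\<ge>1. P (fst e i)"
    by eventually_elim (auto simp: le_iff_add)
next
  assume "AE e in \<mu>. P (snd e 1)"
  from environment_AE_shift[OF this] have "AE e in \<mu>. \<forall>k. P (snd e (1 + k))"
    by (simp add: AE_all_countable shift2_funpow[of 1, simplified])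
  then show "AE e in \<mu>. \<forall>i\<ge>1. P (snd e i)"
    by eventually_elim (auto simp: le_iff_add)
qed

end

section \<open>Identification of the shape function\<close>

text \<open>
  The upper bound holds at every tilt. For the lower bound the functions \<open>L - \<epsilon> * A\<close> and
  \<open>L - \<epsilon> * B\<close> have derivatives \<open>- \<epsilon> * A' > 0\<close> and \<open>- \<epsilon> * B' < 0\<close> at \<open>z\<close>, so they are smaller than at
  \<open>z\<close> slightly to the left and slightly to the right, respectively. This excludes the last two
  terms of \<open>stationary_constant_le_max\<close>.
\<close>
lemma passage_constant_at_critical_tilt:
  fixes G :: ereal and A B :: "real \<Rightarrow> real"
  assumes prob: "prob_space \<mu>" and c: "c > 0"
    and ge: "AE e in \<mu>. (\<forall>i\<ge>1. c \<le> fst e i) \<and> (\<forall>i\<ge>1. c \<le> snd e i)"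
    and averages: "\<And>u. \<bar>u\<bar> < c \<Longrightarrow> AE e in \<mu>. ((\<lambda>n. (\<Sum>i\<in>{1..n}. 1 / (fst e i + u)) / real n) \<longlonglongrightarrow> A u)
      \<and> ((\<lambda>n. (\<Sum>i\<in>{1..n}. 1 / (snd e i - u)) / real n) \<longlonglongrightarrow> B u)"
    and limit: "AE e in \<mu>. AE W in extended_law e.
      (\<lambda>n. ereal (last_passage W (nat \<lfloor>real n * s\<rfloor>) (nat \<lfloor>real n * t\<rfloor>) / real n)) \<longlonglongrightarrow> G"
    and nonneg: "0 \<le> G" and st: "s > 0" "t > 0" and z: "\<bar>z\<bar> < c"
    and DA: "(A has_real_derivative A') (at z)" and DB: "(B has_real_derivative B') (at z)"
    and signs: "A' < 0" "0 < B'" and stationary: "s * A' + t * B' = 0"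
  shows "G = ereal (s * A z + t * B z)"
proof -
  interpret prob_space \<mu> by (rule prob)
  define L where "L u = s * A u + t * B u" for u
  have upper: "G \<le> ereal (L z)"
  proof -
    have "AE e in \<mu>. G \<le> ereal (L z)"
      using ge averages[OF z] limit
    proof eventually_elim
      case (elim e)
      interpret E: exponential_passage "extended_law e" "\<lambda>k \<omega>. \<omega> k" "fst e" "snd e" "c"
        by (rule extended_law_passage) (use elim c in auto)
      show ?case unfolding L_def
        using elim(2) by (intro E.passage_constant_le[OF elim(3) st z]) blast+
    qed
    then show ?thesis by simp
  qed
  moreover have "0 \<le> G" by (rule nonneg)
  ultimately obtain \<gamma> where \<gamma>: "G = ereal \<gamma>" by (cases "G") auto
  have lower: "L z \<le> \<epsilon> * A z + \<epsilon> * B z + \<gamma>" if \<epsilon>: "\<epsilon> > 0" for \<epsilon>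
  proof -
    have "DERIV (\<lambda>u. L u - \<epsilon> * A u) z :> s * A' + t * B' - \<epsilon> * A'"
      unfolding L_def by (auto intro!: derivative_eq_intros DA DB)
    moreover have "0 < s * A' + t * B' - \<epsilon> * A'" using stationary signs \<epsilon> by (simp add: mult_pos_neg)
    ultimately obtain d1 where d1: "d1 > 0" "\<And>h. 0 < h \<Longrightarrow> h < d1 \<Longrightarrow> L (z - h) - \<epsilon> * A (z - h) < L z - \<epsilon> * A z"
      by (auto dest!: DERIV_pos_inc_left)
    have "DERIV (\<lambda>u. L u - \<epsilon> * B u) z :> s * A' + t * B' - \<epsilon> * B'"
      unfolding L_def by (auto intro!: derivative_eq_intros DA DB)
    moreover have "s * A' + t * B' - \<epsilon> * B' < 0" using stationary signs \<epsilon> by simp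
    ultimately obtain d2 where d2: "d2 > 0" "\<And>h. 0 < h \<Longrightarrow> h < d2 \<Longrightarrow> L (z + h) - \<epsilon> * B (z + h) < L z - \<epsilon> * B z"
      by (auto dest!: DERIV_neg_dec_right)
    \<comment> \<open>Both comparison points \<open>z - h\<close> and \<open>z + h\<close> must be close to \<open>z\<close> and admissible as tilts.\<close>
    define h where "h = min (min d1 d2) (c - \<bar>z\<bar>) / 2"
    have "0 < h" "h \<le> d1 / 2" "h \<le> d2 / 2" "h \<le> (c - \<bar>z\<bar>) / 2"
      using d1(1) d2(1) z by (auto simp: h_def)
    then have h: "0 < h" "h < d1" "h < d2" "\<bar>z - h\<bar> < c" "\<bar>z + h\<bar> < c"
      using d1(1) d2(1) z by (simp_all add: abs_less_iff)
    have "AE e in \<mu>. L z \<le> max (\<epsilon> * A z + \<epsilon> * B z + \<gamma>)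
       (max (\<epsilon> * A z - \<epsilon> * A (z - h) + L (z - h)) (\<epsilon> * B z - \<epsilon> * B (z + h) + L (z + h)))"
      using ge averages[OF z] averages[OF h(4)] averages[OF h(5)] limit
    proof eventually_elim
      case (elim e)
      interpret E: exponential_passage "extended_law e" "\<lambda>k \<omega>. \<omega> k" "fst e" "snd e" "c"
        by (rule extended_law_passage) (use elim c in auto)
      show ?case unfolding L_def
      proof (rule E.stationary_constant_le_max[OF _ st \<epsilon> h(4) z h(5)])
        show "AE W in extended_law e. (\<lambda>n. ereal (last_passage W (nat \<lfloor>real n * s\<rfloor>) (nat \<lfloor>real n * t\<rfloor>) / real n)) \<longlonglongrightarrow> ereal \<gamma>"
          using elim(5) unfolding \<gamma> .
        show "(\<lambda>n. (\<Sum>i\<in>{1..n}. 1 / (fst e i + u)) / real n) \<longlonglongrightarrow> A u"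
          "(\<lambda>n. (\<Sum>i\<in>{1..n}. 1 / (snd e i - u)) / real n) \<longlonglongrightarrow> B u" if "u \<in> {z - h, z, z + h}" for u
          using that elim(2,3,4) by blast+
      qed (use h(1) in simp_all)
    qed
    then have "L z \<le> max (\<epsilon> * A z + \<epsilon> * B z + \<gamma>)
       (max (\<epsilon> * A z - \<epsilon> * A (z - h) + L (z - h)) (\<epsilon> * B z - \<epsilon> * B (z + h) + L (z + h)))" by simp
    then show ?thesis using d1(2)[OF h(1,2)] d2(2)[OF h(1,3)] unfolding le_max_iff_disj by argo
  qed
  have "L z \<le> \<gamma>"
  proof (rule field_le_epsilon)
    fix \<delta> :: real assume \<delta>: "\<delta> > 0"
    define C where "C = \<bar>A z + B z\<bar> + 1"
    have C: "0 < C" "A z + B z \<le> C" by (auto simp: C_def)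
    have "L z \<le> \<delta> / C * (A z + B z) + \<gamma>" using lower[of "\<delta> / C"] \<delta> C by (simp add: distrib_left)
    also have "\<delta> / C * (A z + B z) \<le> \<delta> / C * C" using \<delta> C by (intro mult_left_mono) auto
    finally show "L z \<le> \<gamma> + \<delta>" using C by simp
  qed
  with upper \<gamma> show ?thesis by (simp add: L_def)
qed

lemma uniform_reciprocal:
  fixes u v z :: real
  assumes uv: "u < v" "0 < u + z"
  shows "integrable (uniform_measure lborel {u..v}) (\<lambda>x. 1 / (x + z))"
    and "(\<integral>x. 1 / (x + z) \<partial>uniform_measure lborel {u..v}) = (ln (v + z) - ln (u + z)) / (v - u)"
proof -
  have eq: "uniform_measure lborel {u..v} = density lborel (\<lambda>x. ennreal (indicator {u..v} x / (v - u)))"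
    unfolding uniform_measure_def
    by (intro density_cong) (use uv in \<open>auto simp: indicator_def divide_ennreal[symmetric]\<close>)
  have "has_bochner_integral lborel (\<lambda>x. 1 / (x + z) * indicator {u..v} x) (ln (v + z) - ln (u + z))"
  proof (rule has_bochner_integral_FTC_Icc_real)
    fix x assume x: "u \<le> x" "x \<le> v"
    show "DERIV (\<lambda>x. ln (x + z)) x :> 1 / (x + z)"
      using x uv by (auto intro!: derivative_eq_intros)
    show "isCont (\<lambda>x. 1 / (x + z)) x"
      using x uv by (auto intro!: continuous_intros)
  qed (use uv in simp)
  from has_bochner_integral_divide_zero[OF this, of "v - u"]
  have *: "has_bochner_integral lborel (\<lambda>x. (indicator {u..v} x / (v - u)) *\<^sub>R (1 / (x + z))) ((ln (v + z) - ln (u + z)) / (v - u))"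
    by (simp add: mult.commute)
  show "integrable (uniform_measure lborel {u..v}) (\<lambda>x. 1 / (x + z))"
    unfolding eq by (subst integrable_density) (use uv * in \<open>auto simp: has_bochner_integral_iff\<close>)
  show "(\<integral>x. 1 / (x + z) \<partial>uniform_measure lborel {u..v}) = (ln (v + z) - ln (u + z)) / (v - u)"
    unfolding eq by (subst integral_density) (use uv * in \<open>auto simp: has_bochner_integral_iff\<close>)
qed

text \<open>
  With \<open>x = lam / 2 + z\<close> and \<open>y = lam / 2 - z\<close>, the critical equation reads
  \<open>s * y * (y + m) = t * x * (x + l)\<close>. Since \<open>x + y = lam\<close>, it becomes a quadratic equation for
  \<open>r = y / x\<close>, whose positive root is the one below; \<open>r'\<close> is its reciprocal.
\<close>
lemma saddle_point:
  fixes lam l m s t :: real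
  assumes pos: "lam > 0" "l > 0" "m > 0" "s > 0" "t > 0"
  defines "D \<equiv> sqrt ((l * t - m * s)\<^sup>2 + 4 * s * t * (lam + l) * (lam + m))"
  defines "r \<equiv> (l * t - m * s + D) / (2 * s * (lam + m))" and "r' \<equiv> (m * s - l * t + D) / (2 * t * (lam + l))"
  obtains z where "\<bar>z\<bar> < lam / 2"
    "s / ((lam / 2 + z) * (lam / 2 + l + z)) = t / ((lam / 2 - z) * (lam / 2 + m - z))"
    "(lam / 2 + l + z) / (lam / 2 + z) = 1 + l / lam + l / lam * r"
    "(lam / 2 + m - z) / (lam / 2 - z) = 1 + m / lam + m / lam * r'"
proof -
  have rad: "(l * t - m * s)\<^sup>2 < (l * t - m * s)\<^sup>2 + 4 * s * t * (lam + l) * (lam + m)"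
    using pos by simp
  have D2: "D\<^sup>2 = (l * t - m * s)\<^sup>2 + 4 * s * t * (lam + l) * (lam + m)"
    unfolding D_def using pos by (intro real_sqrt_pow2) (simp add: add_nonneg_nonneg)
  have "\<bar>l * t - m * s\<bar> < D" using real_sqrt_less_mono[OF rad] by (simp add: D_def)
  then have r_pos: "0 < r" "0 < r'" unfolding r_def r'_def using pos by (auto intro!: divide_pos_pos)
  have "r * r' = (D\<^sup>2 - (l * t - m * s)\<^sup>2) / (4 * s * t * (lam + l) * (lam + m))"
    unfolding r_def r'_def using pos by (simp add: power2_eq_square field_simps)
  then have rr': "r * r' = 1" using pos by (simp add: D2)
  have quad: "s * (lam + m) * r\<^sup>2 = (l * t - m * s) * r + t * (lam + l)"
  proof -
    have "2 * s * (lam + m) * r = l * t - m * s + D" unfolding r_def using pos by simp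
    then have "(2 * s * (lam + m) * r - (l * t - m * s))\<^sup>2 = (l * t - m * s)\<^sup>2 + 4 * s * t * (lam + l) * (lam + m)"
      using D2 by simp
    then have "4 * s * (lam + m) * (s * (lam + m) * r\<^sup>2) = 4 * s * (lam + m) * ((l * t - m * s) * r + t * (lam + l))"
      by (simp add: power2_eq_square algebra_simps)
    then show ?thesis using pos by simp
  qed
  define x where "x = lam / (1 + r)"
  have x: "0 < x" "x < lam" using r_pos pos by (auto simp: x_def field_simps)
  have y: "lam - x = r * x" using r_pos by (simp add: x_def field_simps)
  have lam: "lam = (1 + r) * x" using y by (simp add: algebra_simps)
  have bal: "s * (r * (r * x + m)) = t * (x + l)"
  proof -
    have "(1 + r) * (s * (r * (r * x + m))) = (1 + r) * (t * (x + l))"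
    proof -
      have "s * ((1 + r) * x + m) * r\<^sup>2 = (l * t - m * s) * r + t * ((1 + r) * x + l)"
        using quad by (simp only: lam[symmetric])
      then show ?thesis by (simp add: power2_eq_square algebra_simps)
    qed
    then show ?thesis using r_pos by simp
  qed
  show ?thesis
  proof (rule that[of "x - lam / 2"])
    show "\<bar>x - lam / 2\<bar> < lam / 2" using x unfolding abs_less_iff by (simp add: field_simps)
    have "s / (x * (x + l)) = t / ((r * x) * (r * x + m))"
      using x r_pos pos bal by (simp add: frac_eq_eq mult_ac add_pos_pos less_imp_neq[symmetric] add_nonneg_eq_0_iff)
    then show "s / ((lam / 2 + (x - lam / 2)) * (lam / 2 + l + (x - lam / 2))) = t / ((lam / 2 - (x - lam / 2)) * (lam / 2 + m - (x - lam / 2)))"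
      by (simp add: y[symmetric] algebra_simps)
    have inv: "1 / x = (1 + r) / lam" by (simp add: x_def)
    have "(lam / 2 + l + (x - lam / 2)) / (lam / 2 + (x - lam / 2)) = 1 + l * (1 / x)"
      using x by (simp add: field_simps)
    then show "(lam / 2 + l + (x - lam / 2)) / (lam / 2 + (x - lam / 2)) = 1 + l / lam + l / lam * r"
      unfolding inv by (simp add: add_divide_distrib distrib_left)
    have r': "1 / r = r'" using rr' r_pos by (simp add: field_simps)
    have "(lam / 2 + m - (x - lam / 2)) / (lam / 2 - (x - lam / 2)) = (r * x + m) / (r * x)"
      by (simp add: y[symmetric] algebra_simps)
    also have "\<dots> = 1 + m * (1 / x) * (1 / r)"
      using x r_pos by (simp add: field_simps)
    also have "\<dots> = 1 + m / lam + m / lam * r'"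
      unfolding inv r' using rr' by (simp add: add_divide_distrib algebra_simps)
    finally show "(lam / 2 + m - (x - lam / 2)) / (lam / 2 - (x - lam / 2)) = 1 + m / lam + m / lam * r'" .
  qed
qed

lemma tilted_mean_derivatives:
  fixes d l m z :: real
  assumes zpos: "0 < d + z" "0 < d - z" and pos: "l > 0" "m > 0"
  shows "((\<lambda>u. (ln (d + l + u) - ln (d + u)) / l) has_real_derivative - 1 / ((d + z) * (d + l + z))) (at z)"
    and "((\<lambda>u. (ln (d + m - u) - ln (d - u)) / m) has_real_derivative 1 / ((d - z) * (d + m - z))) (at z)"
proof -
  have far: "0 < d + l + z" "0 < d + m - z" using zpos pos by linarith+
  have "((\<lambda>u. (ln (d + l + u) - ln (d + u)) / l) has_real_derivative (1 / (d + l + z) - 1 / (d + z)) / l) (at z)"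
    using zpos far pos by (auto intro!: derivative_eq_intros)
  also have "1 / (d + l + z) - 1 / (d + z) = - l / ((d + z) * (d + l + z))"
    using zpos far by (simp add: field_simps)
  finally show "((\<lambda>u. (ln (d + l + u) - ln (d + u)) / l) has_real_derivative - 1 / ((d + z) * (d + l + z))) (at z)"
    using pos by simp
  have "((\<lambda>u. (ln (d + m - u) - ln (d - u)) / m) has_real_derivative (1 / (d - z) - 1 / (d + m - z)) / m) (at z)"
    using zpos far pos by (auto intro!: derivative_eq_intros)
  also have "1 / (d - z) - 1 / (d + m - z) = m / ((d - z) * (d + m - z))"
    using zpos far by (simp add: field_simps)
  finally show "((\<lambda>u. (ln (d + m - u) - ln (d - u)) / m) has_real_derivative 1 / ((d - z) * (d + m - z))) (at z)"
    using pos by simp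
qed

theorem corollary2p4:
  fixes \<mu> :: "((nat \<Rightarrow> real) \<times> (nat \<Rightarrow> real)) measure"
    and g :: "real \<Rightarrow> real \<Rightarrow> ereal"
    and lam l m :: real
  assumes env: "ergodic_environment \<mu>"
    and shape: "is_shape_function \<mu> g"
    and pos: "lam > 0" "l > 0" "m > 0"
    and alpha: "a1_law \<mu> = uniform_measure lborel {lam / 2 .. lam / 2 + l}"
    and beta: "b1_law \<mu> = uniform_measure lborel {lam / 2 .. lam / 2 + m}"
  shows "\<forall>s>0. \<forall>t>0. g s t = ereal (
      s / l * ln (1 + l / lam + l / lam *
        ((l * t - m * s + sqrt ((l * t - m * s)\<^sup>2 + 4 * s * t * (lam + l) * (lam + m)))
          / (2 * s * (lam + m))))
    + t / m * ln (1 + m / lam + m / lam *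
        ((m * s - l * t + sqrt ((l * t - m * s)\<^sup>2 + 4 * s * t * (lam + l) * (lam + m)))
          / (2 * t * (lam + l)))))"
proof (intro allI impI)
  fix s t :: real assume st: "s > 0" "t > 0"
  interpret prob_space \<mu> by (rule environment_prob_space[OF env])
  define A where "A u = (ln (lam / 2 + l + u) - ln (lam / 2 + u)) / l" for u
  define B where "B u = (ln (lam / 2 + m - u) - ln (lam / 2 - u)) / m" for u
  note meas = environment_component_measurable[OF env order_refl]
  have a1: "a1_law \<mu> = distr \<mu> borel (\<lambda>e. fst e 1)" and b1: "b1_law \<mu> = distr \<mu> borel (\<lambda>e. snd e 1)"
    by (simp_all add: a1_law_def b1_law_def case_prod_unfold)
  have ge: "AE e in \<mu>. (\<forall>i\<ge>1. lam / 2 \<le> fst e i) \<and> (\<forall>i\<ge>1. lam / 2 \<le> snd e i)"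
  proof -
    have "AE x in a1_law \<mu>. lam / 2 \<le> x" "AE x in b1_law \<mu>. lam / 2 \<le> x"
      unfolding alpha beta by (auto intro!: AE_uniform_measureI)
    then have "AE e in \<mu>. lam / 2 \<le> fst e 1" "AE e in \<mu>. lam / 2 \<le> snd e 1"
      unfolding a1 b1 using AE_distrD[OF meas(1), of "\<lambda>x. lam / 2 \<le> x"] AE_distrD[OF meas(2), of "\<lambda>x. lam / 2 \<le> x"] by blast+
    from environment_AE_all(1)[OF env this(1)] environment_AE_all(2)[OF env this(2)] show ?thesis
      by eventually_elim simp
  qed
  have averages: "AE e in \<mu>. ((\<lambda>n. (\<Sum>i\<in>{1..n}. 1 / (fst e i + u)) / real n) \<longlonglongrightarrow> A u)
      \<and> ((\<lambda>n. (\<Sum>i\<in>{1..n}. 1 / (snd e i - u)) / real n) \<longlonglongrightarrow> B u)" if u: "\<bar>u\<bar> < lam / 2" for u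
  proof -
    have ua: "integrable (a1_law \<mu>) (\<lambda>x. 1 / (x + u))" "(\<integral>x. 1 / (x + u) \<partial>a1_law \<mu>) = A u"
      using uniform_reciprocal[of "lam / 2" "lam / 2 + l" u] u pos by (auto simp: alpha A_def)
    have ub: "integrable (b1_law \<mu>) (\<lambda>x. 1 / (x - u))" "(\<integral>x. 1 / (x - u) \<partial>b1_law \<mu>) = B u"
      using uniform_reciprocal[of "lam / 2" "lam / 2 + m" "- u"] u pos by (auto simp: beta B_def)
    have "integrable \<mu> (\<lambda>e. 1 / (fst e 1 + u))" "(\<integral>e. 1 / (fst e 1 + u) \<partial>\<mu>) = A u"
      using ua meas unfolding a1 by (simp_all add: integrable_distr_eq integral_distr)
    moreover have "integrable \<mu> (\<lambda>e. 1 / (snd e 1 - u))" "(\<integral>e. 1 / (snd e 1 - u) \<partial>\<mu>) = B u"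
      using ub meas unfolding b1 by (simp_all add: integrable_distr_eq integral_distr)
    ultimately show ?thesis
      using environment_averages(1)[OF env, of "\<lambda>x. 1 / (x + u)"] environment_averages(2)[OF env, of "\<lambda>x. 1 / (x - u)"]
      by simp
  qed
  have limit: "AE e in \<mu>. AE W in extended_law e. (\<lambda>n. ereal (last_passage W (nat \<lfloor>real n * s\<rfloor>) (nat \<lfloor>real n * t\<rfloor>) / real n)) \<longlonglongrightarrow> g s t"
  proof -
    have "AE W in weight_law \<mu>. (\<lambda>n. ereal (last_passage W (nat \<lfloor>real n * s\<rfloor>) (nat \<lfloor>real n * t\<rfloor>) / real n)) \<longlonglongrightarrow> g s t"
    proof -
      have "AE W in weight_law \<mu>. \<forall>s>0. \<forall>t>0.
        (\<lambda>n. ereal (last_passage W (nat \<lfloor>real n * s\<rfloor>) (nat \<lfloor>real n * t\<rfloor>) / real n)) \<longlonglongrightarrow> g s t"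
        using shape unfolding is_shape_function_def by blast
      then show ?thesis by eventually_elim (use st in blast)
    qed
    from AE_cond_weight_law[OF prob_space_axioms environment_sets[OF env] this] ge show ?thesis
    proof eventually_elim
      case (elim e)
      have "0 < lam / 2" using pos by simp
      from AE_extended_law[OF this _ _ elim(1)] elim(2) show ?case
        unfolding last_passage_restrict by blast
    qed
  qed
  obtain z where z: "\<bar>z\<bar> < lam / 2"
    and crit: "s / ((lam / 2 + z) * (lam / 2 + l + z)) = t / ((lam / 2 - z) * (lam / 2 + m - z))"
    and ratios: "(lam / 2 + l + z) / (lam / 2 + z) = 1 + l / lam + l / lam *
        ((l * t - m * s + sqrt ((l * t - m * s)\<^sup>2 + 4 * s * t * (lam + l) * (lam + m))) / (2 * s * (lam + m)))"
      "(lam / 2 + m - z) / (lam / 2 - z) = 1 + m / lam + m / lam *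
        ((m * s - l * t + sqrt ((l * t - m * s)\<^sup>2 + 4 * s * t * (lam + l) * (lam + m))) / (2 * t * (lam + l)))"
    by (rule saddle_point[OF pos st])
  define A' where "A' = - 1 / ((lam / 2 + z) * (lam / 2 + l + z))"
  define B' where "B' = 1 / ((lam / 2 - z) * (lam / 2 + m - z))"
  define L where "L u = s * A u + t * B u" for u
  have zpos: "0 < lam / 2 + z" "0 < lam / 2 - z" using z by auto
  have DA: "(A has_real_derivative A') (at z)" and DB: "(B has_real_derivative B') (at z)"
    unfolding A_def B_def A'_def B'_def using tilted_mean_derivatives[OF zpos pos(2,3)] by blast+
  have signs: "A' < 0" "0 < B'"
  proof -
    have "0 < lam / 2 + l + z" "0 < lam / 2 + m - z" using zpos pos by linarith+
    then show "A' < 0" "0 < B'" using zpos unfolding A'_def B'_def by (simp_all add: divide_neg_pos)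
  qed
  have stationary: "s * A' + t * B' = 0" using crit by (simp add: A'_def B'_def)
  have half: "lam / 2 > 0" using pos by simp
  have nonneg: "0 \<le> g s t" using shape st unfolding is_shape_function_def by blast
  have "g s t = ereal (L z)"
    unfolding L_def
    by (rule passage_constant_at_critical_tilt[OF prob_space_axioms half ge averages limit nonneg st z DA DB signs stationary])
  also have "L z = s / l * ln ((lam / 2 + l + z) / (lam / 2 + z)) + t / m * ln ((lam / 2 + m - z) / (lam / 2 - z))"
    using zpos pos by (simp add: L_def A_def B_def ln_div)
  finally show "g s t = ereal (
      s / l * ln (1 + l / lam + l / lam *
        ((l * t - m * s + sqrt ((l * t - m * s)\<^sup>2 + 4 * s * t * (lam + l) * (lam + m)))
          / (2 * s * (lam + m))))
    + t / m * ln (1 + m / lam + m / lam *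
        ((m * s - l * t + sqrt ((l * t - m * s)\<^sup>2 + 4 * s * t * (lam + l) * (lam + m)))
          / (2 * t * (lam + l)))))"
    unfolding ratios .
qed

end
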